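(* Let $X$ be a Banach space over the real or complex scalars and let $(x_n)_{n\in\mathbb{N}}\subset X$ be a seminormalized, weakly null sequence such that no subsequence of $(x_n)$ generates a spreading model equivalent to the canonical $c_0$ basis. Then for any $\varepsilon>0$, there exists a subsequence $(y_n)$ of $(x_n)$ which is a quasi-greedy basis for its closed linear span with constant $1+\varepsilon$.
   Context: $\mathbb{N}=\{1,2,\ldots\}$. $c_{00}$ denotes the space of scalar sequences with finite support. A sequence $(x_n)$ is seminormalized if $0<\inf_n\|x_n\|\leqslant\sup_n\|x_n\|<\infty$. A sequence $(x_n)$ in a Banach space generates the sequence $(s_n)$ in a possibly different Banach space as a spreading model if for each $k\in\mathbb{N}$ and $\varepsilon>0$ there exists $m=m(k,\varepsilon)$ such that for any $m\leqslant n_1<\cdots<n_k$ and any scalars $(a_i)_{i=1}^k$ with $|a_i|\leqslant 1$ for all $i$, $\bigl|\,\|\sum_{i=1}^k a_i s_i\|-\|\sum_{i=1}^k a_i x_{n_i}\|\,\bigr|<\varepsilon$. The sequence $(s_n)$ is equivalent to the canonical $c_0$ basis if there are constants $0<c\leqslant C<\infty$ such that $c\max_i|a_i|\leqslant\|\sum_i a_i s_i\|\leqslant C\max_i|a_i|$ for all $(a_i)\in c_{00}$. Let $(e_i)$ be a seminormalized (Schauder) basis of a Banach space $Y$. For $n\in\mathbb{N}$ and $x=\sum_i a_i e_i\in Y$, let $G_n(x)=\sum_{i\in A}a_i e_i$, where $A\subset\mathbb{N}$ satisfies $|A|=n$ and $\min_{i\in A}|a_i|\geqslant\max_{i\in\mathbb{N}\setminus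 A}|a_i|$ (such a set $A$ is not unique in general). The basis $(e_i)$ is quasi-greedy with constant $C$ if $\|G_n(x)\|\leqslant C\|x\|$ for all $x\in Y$, all $n\in\mathbb{N}$, and every such choice of $A$. *)

theory Defs
  imports "HOL-Analysis.Analysis"
begin

text \<open>
  The scalar field is a type \<open>'k\<close> of sort \<open>{real_normed_field, euclidean_space}\<close>. Both
  \<open>real\<close> and \<open>complex\<close> have this sort and, by Frobenius' theorem, every such field is
  isometrically isomorphic to one of them.

  The class \<open>banach\<close> supplies only a real vector space structure, so multiplication by scalars
  from \<open>'k\<close> is passed explicitly. For \<open>'k = real\<close> the axioms below force \<open>scl\<close> to be
  \<open>scaleR\<close>.
\<close>

locale banach_space_over = vector_space scl
  for scl :: "'k::{real_normed_field, euclidean_space} \<Rightarrow> 'a::banach \<Rightarrow> 'a" +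
  assumes norm_scale: "norm (scl c x) = norm c * norm x"
    and scale_of_real: "scl (of_real r) x = r *\<^sub>R x"

lemma banach_space_over_scaleR:
  "banach_space_over (scaleR :: real \<Rightarrow> 'a::banach \<Rightarrow> 'a)"
  by unfold_locales (auto simp: algebra_simps)

lemma banach_space_over_mult:
  "banach_space_over ((*) :: 'k::{real_normed_field, euclidean_space} \<Rightarrow> 'k \<Rightarrow> 'k)"
  by unfold_locales (auto simp: algebra_simps norm_mult scaleR_conv_of_real)

text \<open>
  The type \<open>nat \<Rightarrow>\<^sub>C 'k\<close> of bounded functions on the discrete space \<open>nat\<close>, with the supremum
  norm, is the Banach space \<open>\<ell>\<^sub>\<infinity>\<close> over \<open>'k\<close>.
\<close>

definition linf_scale ::
  "'k::{real_normed_field, euclidean_space} \<Rightarrow> (nat \<Rightarrow>\<^sub>C 'k) \<Rightarrow> (nat \<Rightarrow>\<^sub>C 'k)"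
  where "linf_scale c f = Bcontfun (\<lambda>n. c * f n)"

lemma apply_linf_scale [simp]: "apply_bcontfun (linf_scale c f) n = c * apply_bcontfun f n"
proof -
  have "(\<lambda>n. c * apply_bcontfun f n) \<in> bcontfun"
    by (rule bcontfun_normI[where b = "norm c * norm f"])
       (auto intro!: mult_left_mono norm_bounded simp: norm_mult)
  then show ?thesis
    by (simp add: linf_scale_def Bcontfun_inverse)
qed

text \<open>
  The library proves completeness of \<open>bcontfun\<close> only over metric domains, which does not cover
  \<open>nat\<close>.
\<close>

instance bcontfun :: (topological_space, complete_space) complete_space
proof
  fix f :: "nat \<Rightarrow> 'a \<Rightarrow>\<^sub>C 'b"
  assume "Cauchy f"
  then obtain g where "uniform_limit UNIV f g sequentially"
    using uniformly_convergent_eq_cauchy[of "\<lambda>_. True" f]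
    unfolding Cauchy_def uniform_limit_sequentially_iff
    by (metis dist_fun_lt_imp_dist_val_lt)
  from uniform_limit_bcontfunE[OF this sequentially_bot]
  obtain l where "f \<longlonglongrightarrow> l" by metis
  then show "convergent f"
    by (rule convergentI)
qed

instance bcontfun :: (topological_space, banach) banach ..

lemma norm_linf_scale: "norm (linf_scale c f) = norm c * norm f"
proof (rule antisym)
  show le: "norm (linf_scale c f) \<le> norm c * norm f" for c and f :: "nat \<Rightarrow>\<^sub>C 'a"
    by (rule norm_bound) (auto intro!: mult_left_mono norm_bounded simp: norm_mult)
  show "norm c * norm f \<le> norm (linf_scale c f)"
  proof (cases "c = 0")
    case False
    have "linf_scale (inverse c) (linf_scale c f) = f"
      by (rule bcontfun_eqI) (simp add: False)
    with le[of "inverse c" "linf_scale c f"]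
    have "norm f \<le> inverse (norm c) * norm (linf_scale c f)"
      by (simp only: norm_inverse)
    with False show ?thesis
      by (simp add: field_simps)
  qed simp
qed

lemma banach_space_over_linf_scale:
  "banach_space_over (linf_scale :: 'k::{real_normed_field, euclidean_space} \<Rightarrow> _)"
  by unfold_locales
     (auto intro!: bcontfun_eqI simp: algebra_simps norm_linf_scale scaleR_conv_of_real)

definition seminormalized :: "(nat \<Rightarrow> 'a::real_normed_vector) \<Rightarrow> bool"
  where "seminormalized x \<longleftrightarrow>
    0 < (INF n. norm (x n)) \<and> bdd_above (range (\<lambda>n. norm (x n)))"

definition weakly_null ::
  "('k::{real_normed_field, euclidean_space} \<Rightarrow> 'a::banach \<Rightarrow> 'a) \<Rightarrow> (nat \<Rightarrow> 'a) \<Rightarrow> bool"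
  where "weakly_null scl x \<longleftrightarrow>
    (\<forall>f. Vector_Spaces.linear scl (*) f \<and> continuous_on UNIV f
      \<longrightarrow> (\<lambda>n. f (x n)) \<longlonglongrightarrow> 0)"

definition generates_spreading_model ::
  "('k::{real_normed_field, euclidean_space} \<Rightarrow> 'a::banach \<Rightarrow> 'a) \<Rightarrow> (nat \<Rightarrow> 'a) \<Rightarrow>
   ('k \<Rightarrow> 'b::banach \<Rightarrow> 'b) \<Rightarrow> (nat \<Rightarrow> 'b) \<Rightarrow> bool"
  where "generates_spreading_model scl x scl' s \<longleftrightarrow>
    (\<forall>k. \<forall>\<epsilon>>0. \<exists>m. \<forall>n a.
      strict_mono_on {..<k} n \<and> (\<forall>i<k. m \<le> n i) \<and> (\<forall>i<k. norm (a i) \<le> 1) \<longrightarrow>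
      \<bar>norm (\<Sum>i<k. scl' (a i) (s i)) - norm (\<Sum>i<k. scl (a i) (x (n i)))\<bar> < \<epsilon>)"

definition equivalent_c0_basis ::
  "('k::{real_normed_field, euclidean_space} \<Rightarrow> 'b::banach \<Rightarrow> 'b) \<Rightarrow> (nat \<Rightarrow> 'b) \<Rightarrow> bool"
  where "equivalent_c0_basis scl s \<longleftrightarrow>
    (\<exists>c C. 0 < c \<and> c \<le> C \<and>
      (\<forall>a. finite {i. a i \<noteq> 0} \<longrightarrow>
        c * (SUP i. norm (a i)) \<le> norm (\<Sum>i | a i \<noteq> 0. scl (a i) (s i)) \<and>
        norm (\<Sum>i | a i \<noteq> 0. scl (a i) (s i)) \<le> C * (SUP i. norm (a i))))"

text \<open>
  A spreading model may live in an arbitrary Banach space, and HOL cannot quantify over types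
  inside a formula. The property depends only on the closed linear span of \<open>s\<close>, which is
  separable, and every separable Banach space over \<open>'k\<close> embeds linearly and isometrically into
  \<open>\<ell>\<^sub>\<infinity>\<close>. Hence nothing is lost by taking \<open>s\<close> in \<open>\<ell>\<^sub>\<infinity>\<close>.
\<close>

definition has_c0_spreading_model ::
  "('k::{real_normed_field, euclidean_space} \<Rightarrow> 'a::banach \<Rightarrow> 'a) \<Rightarrow> (nat \<Rightarrow> 'a) \<Rightarrow> bool"
  where "has_c0_spreading_model scl x \<longleftrightarrow>
    (\<exists>s :: nat \<Rightarrow> (nat \<Rightarrow>\<^sub>C 'k).
      generates_spreading_model scl x linf_scale s \<and> equivalent_c0_basis linf_scale s)"

definition closed_linear_span ::
  "('k::{real_normed_field, euclidean_space} \<Rightarrow> 'a::banach \<Rightarrow> 'a) \<Rightarrow> 'a set \<Rightarrow> 'a set"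
  where "closed_linear_span scl S = closure (module.span scl S)"

definition schauder_basis ::
  "('k::{real_normed_field, euclidean_space} \<Rightarrow> 'a::banach \<Rightarrow> 'a) \<Rightarrow> (nat \<Rightarrow> 'a) \<Rightarrow> 'a set \<Rightarrow> bool"
  where "schauder_basis scl e Y \<longleftrightarrow>
    range e \<subseteq> Y \<and> (\<forall>y\<in>Y. \<exists>!a. (\<lambda>i. scl (a i) (e i)) sums y)"

text \<open>
  The admissible index sets for the \<open>n\<close>-th greedy approximant of a vector with coefficients
  \<open>a\<close>.
\<close>

definition greedy_set :: "(nat \<Rightarrow> 'k::real_normed_vector) \<Rightarrow> nat \<Rightarrow> nat set \<Rightarrow> bool"
  where "greedy_set a n A \<longleftrightarrow>
    finite A \<and> card A = n \<and> (\<forall>i\<in>A. \<forall>j. j \<notin> A \<longrightarrow> norm (a j) \<le> norm (a i))"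

definition quasi_greedy_basis ::
  "('k::{real_normed_field, euclidean_space} \<Rightarrow> 'a::banach \<Rightarrow> 'a) \<Rightarrow> (nat \<Rightarrow> 'a) \<Rightarrow> 'a set \<Rightarrow>
   real \<Rightarrow> bool"
  where "quasi_greedy_basis scl e Y C \<longleftrightarrow>
    seminormalized e \<and> schauder_basis scl e Y \<and>
    (\<forall>y\<in>Y. \<forall>a n A. (\<lambda>i. scl (a i) (e i)) sums y \<and> 1 \<le> n \<and> greedy_set a n A \<longrightarrow>
      norm (\<Sum>i\<in>A. scl (a i) (e i)) \<le> C * norm y)"

end

theory Submission
  imports Defs
begin

text \<open>
  The proof combines two facts about a seminormalized weakly null sequence.

  \<^item> Suppression (\<open>schreier_suppression\<close>). Given a function \<open>M\<close> and \<open>e > 0\<close>, some subsequence \<open>y\<close>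
    has the property that restricting a vector \<open>\<Sum>i. a\<^sub>i y\<^sub>i\<close> to an initial segment \<open>[0, j)\<close> together with
    at most \<open>M j\<close> indices beyond \<open>j\<close> increases the norm by a factor of at most \<open>1 + e\<close>. To see this,
    consider the functional that norms the restricted vector. Let the retained indices tend
    to infinity one after the other along an ultrafilter. The limit functionals are small at far out
    terms of the weakly null sequence, and the norming functionals are close to their limits at
    terms chosen earlier. So a careful choice of the subsequence makes each norming functional nearly
    vanish at every term beyond \<open>j\<close> that is not retained.

  \<^item> Largeness (\<open>far_sums_large\<close>). Some subsequence generates a spreading model, which is unconditional
    by the suppression property. It is not equivalent to the basis of \<open>c\<^sub>0\<close>, so the norms of the sums
    of its first \<open>k\<close> terms are unbounded. Hence for each \<open>\<delta> > 0\<close> there is \<open>k\<close> such that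
    a far out sum of \<open>k\<close> terms with coefficients of modulus at least \<open>\<delta>\<close> has large norm.

  Now let \<open>\<Sum>i. a\<^sub>i y\<^sub>i\<close> have norm \<open>1\<close>, let \<open>A\<close> be a greedy set, \<open>\<delta>\<close> the least modulus of a
  coefficient in \<open>A\<close>, and \<open>j\<close> least with \<open>e / (j + 1) \<le> \<delta>\<close>. By largeness \<open>A\<close> has fewer than \<open>k\<^sub>j\<close> elements
  beyond \<open>j\<close>, where \<open>k\<^sub>j\<close> depends on \<open>j\<close> only. If suppression has been arranged for \<open>M j = k\<^sub>j\<close>, restricting
  to \<open>[0, j) \<union> A\<close> costs a factor \<open>1 + e\<close>. The coefficients in \<open>[0, j)\<close> outside \<open>A\<close> have modulus at most \<open>\<delta>\<close>,
  so they contribute at most \<open>j \<delta> sup \<parallel>y\<^sub>i\<parallel> \<le> e sup \<parallel>y\<^sub>i\<parallel>\<close> (\<open>greedy_bound_finite\<close>).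
\<close>

section \<open>Minimal elements and ultrafilters\<close>
text \<open>
  Zorn's lemma in the downward direction. It yields both the ultrafilters (minimal proper filters)
  and the linear functionals (minimal sublinear functions) of this development.
\<close>
lemma Zorn_minimal:
  fixes A :: "'a::order set"
  assumes "A \<noteq> {}"
    and chain: "\<And>C. \<lbrakk>C \<subseteq> A; C \<noteq> {}; \<forall>a\<in>C. \<forall>b\<in>C. a \<le> b \<or> b \<le> a\<rbrakk> \<Longrightarrow> \<exists>l\<in>A. \<forall>a\<in>C. l \<le> a"
  obtains m where "m \<in> A" "\<And>a. \<lbrakk>a \<in> A; a \<le> m\<rbrakk> \<Longrightarrow> a = m"
proof -
  let ?P = "\<lambda>a b :: 'a. b \<le> a"
  have "partial_order_on A (relation_of ?P A)"
    by (rule partial_order_on_relation_ofI) auto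
  moreover have "\<exists>l\<in>A. \<forall>a\<in>C. ?P a l" if "C \<in> Chains (relation_of ?P A)" for C
  proof (cases "C = {}")
    case True
    then show ?thesis using \<open>A \<noteq> {}\<close> by auto
  next
    case False
    have "C \<subseteq> A" "\<forall>a\<in>C. \<forall>b\<in>C. a \<le> b \<or> b \<le> a"
      using that by (auto simp: Chains_def relation_of_def)
    with chain False show ?thesis by auto
  qed
  ultimately have "\<exists>m\<in>A. \<forall>a\<in>A. ?P m a \<longrightarrow> a = m"
    by (rule predicate_Zorn)
  then show thesis using that by auto
qed

text \<open>
  A minimal proper filter \<open>U\<close> decides every predicate \<open>P\<close>: if \<open>\<not> P\<close> is not eventually true, then
  restricting \<open>U\<close> to \<open>P\<close> gives a proper filter below \<open>U\<close>, which is \<open>U\<close> itself.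
\<close>
lemma ultrafilter_exists:
  fixes F0 :: "'i filter"
  assumes "F0 \<noteq> bot"
  obtains U where "U \<le> F0" "U \<noteq> bot"
    "\<And>P. eventually P U \<or> eventually (\<lambda>i. \<not> P i) U"
proof -
  let ?A = "{F. F \<noteq> bot \<and> F \<le> F0}"
  have "\<exists>l\<in>?A. \<forall>a\<in>C. l \<le> a"
    if "C \<subseteq> ?A" "C \<noteq> {}" and ch: "\<forall>a\<in>C. \<forall>b\<in>C. a \<le> b \<or> b \<le> a" for C
  proof (intro bexI[of _ "Inf C"] ballI)
    have "eventually P (Inf C) \<longleftrightarrow> (\<exists>b\<in>C. eventually P b)" for P
    proof (rule eventually_Inf_base[OF \<open>C \<noteq> {}\<close>])
      fix F G assume "F \<in> C" "G \<in> C"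
      then show "\<exists>x\<in>C. x \<le> inf F G"
        using ch by (metis le_inf_iff order_refl)
    qed
    from this[of "\<lambda>_. False"] have "Inf C \<noteq> bot"
      using \<open>C \<subseteq> ?A\<close> unfolding trivial_limit_def by auto
    moreover have "Inf C \<le> F0"
    proof -
      obtain F where "F \<in> C" using \<open>C \<noteq> {}\<close> by auto
      with \<open>C \<subseteq> ?A\<close> have "F \<le> F0" by auto
      with \<open>F \<in> C\<close> show ?thesis by (rule Inf_lower2)
    qed
    ultimately show "Inf C \<in> ?A" by simp
    show "Inf C \<le> a" if "a \<in> C" for a using that by (rule Inf_lower)
  qed
  then obtain U where U: "U \<in> ?A" and min: "\<And>a. \<lbrakk>a \<in> ?A; a \<le> U\<rbrakk> \<Longrightarrow> a = U"
    using Zorn_minimal[of ?A] assms by blast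
  have "eventually P U \<or> eventually (\<lambda>i. \<not> P i) U" for P
  proof (rule disjCI)
    assume ev: "\<not> eventually (\<lambda>i. \<not> P i) U"
    then have "inf U (principal {i. P i}) \<noteq> bot"
      unfolding trivial_limit_def eventually_inf_principal by simp
    moreover have "inf U (principal {i. P i}) \<le> F0"
      using U by (simp add: le_infI1)
    ultimately have "inf U (principal {i. P i}) = U"
      using min by simp
    then show "eventually P U"
      using eventually_inf_principal[of P U "{i. P i}"] by simp
  qed
  with U show thesis by (intro that[of U]) simp_all
qed

text \<open>
  A bounded function has a cluster point by compactness, and an ultrafilter converges to each of
  its cluster points.
\<close>
lemma ultrafilter_tendsto:
  fixes g :: "'i \<Rightarrow> 'b::heine_borel"
  assumes "U \<noteq> bot" "\<And>P. eventually P U \<or> eventually (\<lambda>i. \<not> P i) U"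
    and "bounded (range g)"
  shows "(g \<longlongrightarrow> Lim U g) U"
proof -
  have "compact (closure (range g))"
    using assms(3) by (simp add: compact_eq_bounded_closed bounded_closure)
  moreover have "eventually (\<lambda>y. y \<in> closure (range g)) (filtermap g U)"
    by (simp add: eventually_filtermap closure_subset[THEN subsetD])
  moreover have "filtermap g U \<noteq> bot"
    using assms(1) by (simp add: filtermap_bot_iff)
  ultimately obtain l where l: "inf (nhds l) (filtermap g U) \<noteq> bot"
    unfolding compact_filter by blast
  have "(g \<longlongrightarrow> l) U"
  proof (rule topological_tendstoI)
    fix S assume "open S" "l \<in> S"
    then have ev: "eventually (\<lambda>y. y \<in> S) (nhds l)"
      by (auto simp: eventually_nhds)
    show "eventually (\<lambda>i. g i \<in> S) U"
    proof (rule ccontr)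
      assume "\<not> ?thesis"
      with assms(2)[of "\<lambda>i. g i \<in> S"] have "eventually (\<lambda>y. y \<notin> S) (filtermap g U)"
        by (simp add: eventually_filtermap)
      with ev have "eventually (\<lambda>_. False) (inf (nhds l) (filtermap g U))"
        unfolding eventually_inf by blast
      with l show False by (simp add: trivial_limit_def)
    qed
  qed
  then show ?thesis
    using assms(1) by (simp add: tendsto_Lim)
qed

section \<open>The Hahn-Banach theorem\<close>
definition sublinear :: "('a::real_vector \<Rightarrow> real) \<Rightarrow> bool"
  where "sublinear p \<longleftrightarrow>
    (\<forall>u v. p (u + v) \<le> p u + p v) \<and> (\<forall>c v. 0 \<le> c \<longrightarrow> p (c *\<^sub>R v) = c * p v)"

lemma sublinear_add: "sublinear p \<Longrightarrow> p (u + v) \<le> p u + p v"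
  and sublinear_scale: "sublinear p \<Longrightarrow> 0 \<le> c \<Longrightarrow> p (c *\<^sub>R v) = c * p v"
  and sublinear_zero: "sublinear p \<Longrightarrow> p 0 = 0"
  unfolding sublinear_def by (auto dest: spec[of _ "0::real"])

lemma sublinear_minus: "sublinear p \<Longrightarrow> - p (- v) \<le> p v"
  using sublinear_add[of p v "- v"] sublinear_zero[of p] by simp

lemma sublinear_lower:
  assumes p: "sublinear p" and "0 \<le> (t::real)"
  shows "- p (- v) \<le> p (v + t *\<^sub>R y) - t * p y"
proof -
  have "t * p y \<le> p (v + t *\<^sub>R y) + p (- v)"
    using sublinear_add[OF p, of "v + t *\<^sub>R y" "- v"] sublinear_scale[OF p \<open>0 \<le> t\<close>, of y]
    by simp
  then show ?thesis by simp
qed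

text \<open>
  This is the engine of the Hahn-Banach theorem. The function
  \<open>q v = inf {p (v + t y) - t p y | t \<ge> 0}\<close> is sublinear and lies below \<open>p\<close>. If \<open>p\<close> is minimal among
  the sublinear functions, then \<open>q = p\<close> and the last inequality forces \<open>p\<close> to be additive at \<open>y\<close>.
\<close>
lemma sublinear_shave:
  assumes p: "sublinear p"
  obtains q where "sublinear q" "q \<le> p" "\<And>v. q v \<le> p (v + y) - p y"
proof
  let ?S = "\<lambda>v. (\<lambda>t. p (v + t *\<^sub>R y) - t * p y) ` {0..}"
  let ?q = "\<lambda>v. Inf (?S v)"
  have bdd: "bdd_below (?S v)" for v
    using sublinear_lower[OF p] by (intro bdd_belowI[of _ "- p (- v)"]) auto
  have le: "?q v \<le> p (v + t *\<^sub>R y) - t * p y" if "0 \<le> t" for v t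
    using that by (intro cInf_lower[OF _ bdd]) auto
  have ge: "c \<le> ?q v" if "\<And>t. 0 \<le> t \<Longrightarrow> c \<le> p (v + t *\<^sub>R y) - t * p y" for v c
    using that by (intro cInf_greatest) auto
  show "?q \<le> p"
    using le[of 0] by (auto simp: le_fun_def)
  show "?q v \<le> p (v + y) - p y" for v
    using le[of 1 v] by simp
  have add: "?q (u + v) \<le> ?q u + ?q v" for u v
  proof -
    have *: "?q (u + v) \<le> (p (u + s *\<^sub>R y) - s * p y) + (p (v + t *\<^sub>R y) - t * p y)"
      if "0 \<le> s" "0 \<le> t" for s t
    proof -
      have "?q (u + v) \<le> p (u + v + (s + t) *\<^sub>R y) - (s + t) * p y"
        using that by (intro le) simp
      also have "p (u + v + (s + t) *\<^sub>R y) \<le> p (u + s *\<^sub>R y) + p (v + t *\<^sub>R y)"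
        using sublinear_add[OF p, of "u + s *\<^sub>R y" "v + t *\<^sub>R y"] by (simp add: algebra_simps)
      finally show ?thesis by (simp add: algebra_simps)
    qed
    have "?q (u + v) - (p (u + s *\<^sub>R y) - s * p y) \<le> ?q v" if "0 \<le> s" for s
      using *[OF that] by (intro ge) (simp add: algebra_simps)
    then have "?q (u + v) - ?q v \<le> ?q u"
      by (intro ge) (simp add: algebra_simps)
    then show ?thesis by simp
  qed
  have scale_le: "?q (c *\<^sub>R v) \<le> c * ?q v" if "0 < c" for c v
  proof -
    have "?q (c *\<^sub>R v) / c \<le> ?q v"
    proof (rule ge)
      fix t :: real assume "0 \<le> t"
      with \<open>0 < c\<close> have "?q (c *\<^sub>R v) \<le> p (c *\<^sub>R v + (c * t) *\<^sub>R y) - (c * t) * p y"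
        by (intro le) simp
      also have "p (c *\<^sub>R v + (c * t) *\<^sub>R y) = c * p (v + t *\<^sub>R y)"
        using sublinear_scale[OF p, of c "v + t *\<^sub>R y"] \<open>0 < c\<close> by (simp add: algebra_simps)
      finally show "?q (c *\<^sub>R v) / c \<le> p (v + t *\<^sub>R y) - t * p y"
        using \<open>0 < c\<close> by (simp add: field_simps)
    qed
    with \<open>0 < c\<close> show ?thesis by (simp add: field_simps)
  qed
  have scale: "?q (c *\<^sub>R v) = c * ?q v" if "0 < c" for c v
  proof (rule antisym)
    show "?q (c *\<^sub>R v) \<le> c * ?q v" using scale_le[OF that] .
    show "c * ?q v \<le> ?q (c *\<^sub>R v)"
      using scale_le[of "inverse c" "c *\<^sub>R v"] that by (simp add: field_simps)
  qed
  have "?q 0 = 0"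
  proof (rule antisym)
    show "?q 0 \<le> 0" using le[of 0 0] sublinear_zero[OF p] by simp
    show "0 \<le> ?q 0" using sublinear_lower[OF p, of _ 0] sublinear_zero[OF p] by (intro ge) simp
  qed
  then show "sublinear ?q"
    unfolding sublinear_def using add scale by (auto simp: le_less)
qed

text \<open>
  A minimal sublinear function is linear, so it suffices to apply Zorn's lemma below \<open>p\<close>. Starting
  not from \<open>p\<close> but from \<open>p\<close> shaved in the direction \<open>u\<close> keeps the value at \<open>u\<close>.
\<close>
theorem Hahn_Banach_sublinear:
  fixes p :: "'a::real_vector \<Rightarrow> real"
  assumes p: "sublinear p"
  obtains f where "linear f" "\<And>v. f v \<le> p v" "f u = p u"
proof -
  obtain p1 where p1: "sublinear p1" "p1 \<le> p" and p1u: "\<And>v. p1 v \<le> p (v + u) - p u"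
    using sublinear_shave[OF p] by blast
  let ?A = "{q. sublinear q \<and> q \<le> p1}"
  have "\<exists>l\<in>?A. \<forall>a\<in>C. l \<le> a"
    if "C \<subseteq> ?A" "C \<noteq> {}" and ch: "\<forall>a\<in>C. \<forall>b\<in>C. a \<le> b \<or> b \<le> a" for C
  proof -
    \<comment> \<open>The pointwise infimum of a chain is finite since \<open>q v \<ge> - q (- v) \<ge> - p1 (- v)\<close>.\<close>
    let ?l = "\<lambda>v. INF q\<in>C. q v"
    have bdd: "bdd_below ((\<lambda>q. q v) ` C)" for v
    proof (rule bdd_belowI2)
      fix q assume "q \<in> C"
      then have q: "sublinear q" "q \<le> p1" using that by auto
      have "- p1 (- v) \<le> - q (- v)" using q(2) by (simp add: le_fun_def)
      also have "\<dots> \<le> q v" by (rule sublinear_minus[OF q(1)])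
      finally show "- p1 (- v) \<le> q v" .
    qed
    have le: "?l v \<le> q v" if "q \<in> C" for q v
      using that by (intro cINF_lower bdd)
    have "?l (v + w) \<le> ?l v + ?l w" for v w
    proof -
      have *: "?l (v + w) \<le> q v + q' w" if qq: "q \<in> C" "q' \<in> C" for q q'
      proof -
        obtain q0 where q0: "q0 \<in> C" "q0 \<le> q" "q0 \<le> q'"
          using ch qq by (metis order_refl)
        have "?l (v + w) \<le> q0 (v + w)" by (rule le[OF q0(1)])
        also have "\<dots> \<le> q0 v + q0 w" using q0(1) that(1) \<open>C \<subseteq> ?A\<close> by (auto intro: sublinear_add)
        also have "\<dots> \<le> q v + q' w" using q0(2,3) by (intro add_mono) (auto simp: le_fun_def)
        finally show ?thesis .
      qed
      have "?l (v + w) - q v \<le> ?l w" if "q \<in> C" for q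
        using *[OF that] \<open>C \<noteq> {}\<close> by (intro cINF_greatest) (auto simp: algebra_simps)
      then have "?l (v + w) - ?l w \<le> ?l v"
        using \<open>C \<noteq> {}\<close> by (intro cINF_greatest) (auto simp: algebra_simps)
      then show ?thesis by simp
    qed
    moreover have "?l (c *\<^sub>R v) = c * ?l v" if "0 \<le> c" for c v
    proof -
      have "?l (c *\<^sub>R v) = (INF q\<in>C. c * q v)"
        using \<open>C \<subseteq> ?A\<close> that by (intro INF_cong) (auto simp: sublinear_scale)
      also have "\<dots> = c * ?l v"
      proof (rule antisym)
        have "bdd_below ((\<lambda>q. c * q v) ` C)"
          using bdd[of v] that unfolding bdd_below_def by (auto intro!: mult_left_mono)
        then have **: "(INF q\<in>C. c * q v) \<le> c * q v" if "q \<in> C" for q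
          using that by (intro cINF_lower)
        show "(INF q\<in>C. c * q v) \<le> c * ?l v"
        proof (cases "c = 0")
          case True
          then show ?thesis using \<open>C \<noteq> {}\<close> by simp
        next
          case False
          with that have "0 < c" by simp
          have "(INF q\<in>C. c * q v) / c \<le> ?l v"
            using ** \<open>C \<noteq> {}\<close> \<open>0 < c\<close> by (intro cINF_greatest) (auto simp: field_simps)
          with \<open>0 < c\<close> show ?thesis by (simp add: field_simps)
        qed
        show "c * ?l v \<le> (INF q\<in>C. c * q v)"
          using \<open>C \<noteq> {}\<close> that le by (intro cINF_greatest) (auto intro: mult_left_mono)
      qed
      finally show ?thesis .
    qed
    ultimately have "sublinear ?l" by (simp add: sublinear_def)
    moreover have "?l \<le> p1"
    proof (rule le_funI)
      fix v
      obtain q where "q \<in> C" using \<open>C \<noteq> {}\<close> by auto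
      then have "q v \<le> p1 v" using \<open>C \<subseteq> ?A\<close> by (auto simp: le_fun_def)
      with le[OF \<open>q \<in> C\<close>, of v] show "?l v \<le> p1 v" by simp
    qed
    ultimately show ?thesis using le by (intro bexI[of _ ?l]) (auto simp: le_fun_def)
  qed
  moreover have "?A \<noteq> {}" using p1 by auto
  ultimately obtain f where f: "f \<in> ?A" and min: "\<And>a. \<lbrakk>a \<in> ?A; a \<le> f\<rbrakk> \<Longrightarrow> a = f"
    using Zorn_minimal[of ?A] by blast
  then have sf: "sublinear f" and "f \<le> p1" by auto
  have add: "f (v + w) = f v + f w" for v w
  proof (rule antisym)
    show "f (v + w) \<le> f v + f w" by (rule sublinear_add[OF sf])
    obtain q where q: "sublinear q" "q \<le> f" "\<And>v. q v \<le> f (v + w) - f w"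
      using sublinear_shave[OF sf] by blast
    then have "q = f" using min[of q] \<open>f \<le> p1\<close> by auto
    with q(3)[of v] show "f v + f w \<le> f (v + w)" by simp
  qed
  have neg: "f (- v) = - f v" for v
    using add[of v "- v"] sublinear_zero[OF sf] by simp
  have "f (c *\<^sub>R v) = c * f v" for c v
  proof (cases "0 \<le> c")
    case True
    then show ?thesis by (rule sublinear_scale[OF sf])
  next
    case False
    then have "f ((- c) *\<^sub>R v) = (- c) * f v" by (intro sublinear_scale[OF sf]) simp
    then show ?thesis using neg[of "c *\<^sub>R v"] by simp
  qed
  with add have "linear f" by (intro linearI) auto
  moreover have fp: "f v \<le> p v" for v
    using \<open>f \<le> p1\<close> \<open>p1 \<le> p\<close> by (meson le_fun_def order_trans)
  moreover have "f u = p u"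
  proof (rule antisym)
    show "f u \<le> p u" by (rule fp)
    have "f (- u) \<le> p1 (- u)" using \<open>f \<le> p1\<close> by (simp add: le_fun_def)
    also have "\<dots> \<le> - p u" using p1u[of "- u"] sublinear_zero[OF p] by simp
    finally show "p u \<le> f u" using neg by simp
  qed
  ultimately show thesis using that by blast
qed

section \<open>Norming functionals over the scalar field\<close>
text \<open>
  The form \<open>(c, w) \<mapsto> (c * w) \<bullet> 1\<close> plays the role of \<open>Re (c w)\<close>: it is nondegenerate, because
  \<open>1 \<bullet> 1\<close> is not zero.
\<close>
lemma trace_functional_unique:
  fixes w w' :: "'k::{real_normed_field, euclidean_space}"
  assumes "\<And>c. (c * w) \<bullet> 1 = (c * w') \<bullet> 1"
  shows "w = w'"
proof (rule ccontr)
  assume "w \<noteq> w'"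
  then have "inverse (w - w') * w - inverse (w - w') * w' = 1"
    by (simp flip: right_diff_distrib)
  then have "(inverse (w - w') * w) \<bullet> 1 - (inverse (w - w') * w') \<bullet> 1 = (1::'k) \<bullet> 1"
    by (metis inner_diff_left)
  then have "(norm (1::'k))\<^sup>2 = 0"
    using assms[of "inverse (w - w')"] by (simp add: dot_square_norm)
  then show False by simp
qed

text \<open>
  By nondegeneracy the real-linear map \<open>T\<close> with \<open>c \<bullet> T w = (c * w) \<bullet> 1\<close> is injective, hence surjective
  since the scalar field has finite dimension over the reals.
\<close>
lemma trace_functional_representation:
  fixes h :: "'k::{real_normed_field, euclidean_space} \<Rightarrow> real"
  assumes "linear h"
  obtains w where "\<And>c. h c = (c * w) \<bullet> 1"
proof -
  define T :: "'k \<Rightarrow> 'k" where "T = (\<lambda>w. \<Sum>b\<in>Basis. ((b * w) \<bullet> 1) *\<^sub>R b)"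
  have T: "c \<bullet> T w = (c * w) \<bullet> 1" for c w
  proof -
    have "(c * w) \<bullet> 1 = ((\<Sum>b\<in>Basis. (c \<bullet> b) *\<^sub>R b) * w) \<bullet> 1"
      by (simp add: euclidean_representation)
    also have "\<dots> = c \<bullet> T w"
      by (simp add: T_def inner_sum_left inner_sum_right sum_distrib_right mult.commute[of _ "c \<bullet> _"])
    finally show ?thesis by simp
  qed
  have "linear T"
    unfolding T_def
    by (intro linearI) (simp_all add: algebra_simps inner_add_left scaleR_add_left sum.distrib
        scaleR_right.sum)
  moreover have "inj T"
  proof (rule injI)
    fix w w' assume "T w = T w'"
    then show "w = w'" using T trace_functional_unique by metis
  qed
  ultimately obtain w where w: "T w = (\<Sum>b\<in>Basis. h b *\<^sub>R b)"
    by (metis linear_injective_imp_surjective surjD)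
  have "h c = (c * w) \<bullet> 1" for c
  proof -
    have "h c = h (\<Sum>b\<in>Basis. (c \<bullet> b) *\<^sub>R b)" by (simp add: euclidean_representation)
    also have "\<dots> = c \<bullet> T w"
      using assms by (simp add: w linear_sum linear_cmul inner_sum_right mult.commute)
    finally show ?thesis by (simp add: T)
  qed
  then show thesis using that by blast
qed

text \<open>
  The closed unit ball of the dual space, as a set of plain functions, so that it is visibly closed
  under pointwise limits.
\<close>
definition (in banach_space_over) dual_ball :: "('a \<Rightarrow> 'k) set" where
  "dual_ball = {F. (\<forall>u v. F (u + v) = F u + F v) \<and> (\<forall>c v. F (scl c v) = c * F v) \<and>
    (\<forall>v. norm (F v) \<le> norm v)}"

context banach_space_over
begin

lemma dual_ballD:
  assumes "F \<in> dual_ball"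
  shows "F (u + v) = F u + F v" "F (scl c v) = c * F v" "norm (F v) \<le> norm v"
  using assms by (auto simp: dual_ball_def)

lemma dual_ball_zero: "F \<in> dual_ball \<Longrightarrow> F 0 = 0"
  using dual_ballD(3)[of F 0] by simp

lemma dual_ball_sum:
  assumes "F \<in> dual_ball"
  shows "F (\<Sum>i\<in>A. scl (a i) (v i)) = (\<Sum>i\<in>A. a i * F (v i))"
  by (induction A rule: infinite_finite_induct)
     (simp_all add: dual_ballD[OF assms] dual_ball_zero[OF assms])

lemma dual_ball_weakly_null:
  assumes "F \<in> dual_ball" "weakly_null scl x"
  shows "(\<lambda>n. F (x n)) \<longlonglongrightarrow> 0"
proof -
  interpret m: module_hom scl "(*)" F
    by unfold_locales (auto simp: algebra_simps dual_ballD[OF assms(1)])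
  have "Vector_Spaces.linear scl (*) F"
    by unfold_locales
  moreover have "continuous_on UNIV F"
  proof (rule continuous_onI)
    fix v :: 'a and e :: real assume "0 < e"
    have "dist (F w) (F v) < e" if "dist w v < e" for w
    proof -
      have "dist (F w) (F v) = norm (F (w - v))" by (simp add: dist_norm m.diff)
      also have "\<dots> < e" using dual_ballD(3)[OF assms(1), of "w - v"] that by (simp add: dist_norm)
      finally show ?thesis .
    qed
    with \<open>0 < e\<close> show "\<exists>d>0. \<forall>w\<in>UNIV. dist w v < d \<longrightarrow> dist (F w) (F v) \<le> e"
      by (intro exI[of _ e]) (auto intro: less_imp_le)
  qed
  ultimately show ?thesis using assms(2) by (auto simp: weakly_null_def)
qed

lemma scl_scaleR: "scl (r *\<^sub>R c) v = r *\<^sub>R scl c v"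
  by (simp add: scaleR_conv_of_real flip: scale_of_real)

text \<open>
  The Hahn-Banach theorem gives a real-linear \<open>f\<close> that norms \<open>u\<close>. As with complex scalars, \<open>f\<close> is the
  real part of a functional \<open>F\<close> that is linear over the field: \<open>F v\<close> represents the real-linear map
  \<open>c \<mapsto> f (c v)\<close>. Rotating \<open>v\<close> so that \<open>F v\<close> becomes a positive real number shows that \<open>F\<close> has no
  larger norm than \<open>f\<close>.
\<close>
lemma norming_functional:
  obtains F where "F \<in> dual_ball" "norm (F u) = norm u"
proof -
  have "sublinear (norm :: 'a \<Rightarrow> real)"
    by (auto simp: sublinear_def norm_triangle_ineq)
  then obtain f :: "'a \<Rightarrow> real" where "linear f" and f: "\<And>v. f v \<le> norm v" "f u = norm u"
    using Hahn_Banach_sublinear by blast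
  interpret f: linear f by fact
  have "\<exists>w. \<forall>c. f (scl c v) = (c * w) \<bullet> 1" for v
  proof -
    have "linear (\<lambda>c. f (scl c v))"
    proof (rule linearI)
      fix r :: real and c :: 'k
      show "f (scl (r *\<^sub>R c) v) = r *\<^sub>R f (scl c v)" by (simp add: scl_scaleR f.scaleR)
    qed (simp add: scale_left_distrib f.add)
    then show ?thesis using trace_functional_representation by metis
  qed
  then obtain F where F: "\<And>v c. f (scl c v) = (c * F v) \<bullet> 1" by metis
  have "F (v + w) = F v + F w" for v w
    by (rule trace_functional_unique)
       (simp add: scale_right_distrib f.add distrib_left inner_add_left flip: F)
  moreover have "F (scl d v) = d * F v" for d v
    by (rule trace_functional_unique) (simp flip: F mult.assoc)
  moreover have le: "norm (F v) \<le> norm v" for v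
  proof (cases "F v = 0")
    case False
    let ?c = "of_real (norm (F v)) / F v"
    have "?c * F v = of_real (norm (F v))" using False by simp
    then have "norm (F v) = (?c * F v) \<bullet> 1"
      by (simp add: of_real_def dot_square_norm)
    also have "\<dots> = f (scl ?c v)" by (simp only: F)
    also have "\<dots> \<le> norm (scl ?c v)" by (rule f)
    also have "\<dots> = norm v" using False by (simp add: norm_scale norm_divide)
    finally show ?thesis .
  qed simp
  ultimately have "F \<in> dual_ball" by (simp add: dual_ball_def)
  moreover have "norm u \<le> norm (F u)"
  proof -
    have "norm u = F u \<bullet> 1" using F[of 1 u] f(2) by simp
    also have "\<dots> \<le> norm (F u) * norm (1::'k)" by (rule norm_cauchy_schwarz)
    finally show ?thesis by simp
  qed
  ultimately show thesis using le that by (meson antisym)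
qed

end

definition (in banach_space_over) norming :: "'a \<Rightarrow> 'a \<Rightarrow> 'k" where
  "norming u = (SOME F. F \<in> dual_ball \<and> norm (F u) = norm u)"

lemma (in banach_space_over) norming: "norming u \<in> dual_ball" "norm (norming u u) = norm u"
proof -
  have "\<exists>F. F \<in> dual_ball \<and> norm (F u) = norm u"
    using norming_functional by metis
  from someI_ex[OF this] show "norming u \<in> dual_ball" "norm (norming u u) = norm u"
    by (simp_all add: norming_def)
qed

section \<open>Iterated limits and the selection of subsequences\<close>
definition free_ultrafilter :: "nat filter \<Rightarrow> bool" where
  "free_ultrafilter U \<longleftrightarrow> U \<noteq> bot \<and> U \<le> sequentially \<and>
    (\<forall>P. eventually P U \<or> eventually (\<lambda>i. \<not> P i) U)"

lemma free_ultrafilter_exists: "\<exists>U. free_ultrafilter U"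
  using ultrafilter_exists[of sequentially] unfolding free_ultrafilter_def
  by (metis sequentially_bot)

lemma free_ultrafilter_tendsto:
  fixes g :: "nat \<Rightarrow> 'b::heine_borel"
  assumes "free_ultrafilter U" "bounded (range g)"
  shows "(g \<longlongrightarrow> Lim U g) U"
  using assms unfolding free_ultrafilter_def by (intro ultrafilter_tendsto) auto

text \<open>
  For \<open>cs = [c\<^sub>1, \<dots>, c\<^sub>k]\<close> this is the limit of \<open>\<phi> (v + c\<^sub>1 x\<^bsub>n\<^sub>1\<^esub> + \<dots> + c\<^sub>k x\<^bsub>n\<^sub>k\<^esub>) w\<close> as first \<open>n\<^sub>k\<close>, then
  \<open>n\<^bsub>k-1\<^esub>\<close>, and finally \<open>n\<^sub>1\<close> tends to infinity along \<open>U\<close>. With \<open>\<phi> v w = norm v\<close> and \<open>v = 0\<close> it is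
  the norm of a spreading model. With the norming functional of \<open>v\<close>, evaluated at \<open>w\<close>, it is again a functional in
  \<open>w\<close>: what remains of the norming functionals when the positions not yet chosen move to infinity.
\<close>
primrec (in banach_space_over) iterated_lim ::
  "nat filter \<Rightarrow> (nat \<Rightarrow> 'a) \<Rightarrow> ('a \<Rightarrow> 'w \<Rightarrow> 'b::t2_space) \<Rightarrow> 'k list \<Rightarrow> 'a \<Rightarrow> 'w \<Rightarrow> 'b" where
  "iterated_lim U x \<phi> [] v w = \<phi> v w"
| "iterated_lim U x \<phi> (c # cs) v w = Lim U (\<lambda>n. iterated_lim U x \<phi> cs (v + scl c (x n)) w)"

definition locally_bounded :: "('a::real_normed_vector \<Rightarrow> 'w \<Rightarrow> 'b::real_normed_vector) \<Rightarrow> bool" where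
  "locally_bounded \<phi> \<longleftrightarrow> (\<forall>R w. \<exists>\<beta>. \<forall>v. norm v \<le> R \<longrightarrow> norm (\<phi> v w) \<le> \<beta>)"

context banach_space_over
begin

lemma locally_bounded_tendsto_Lim:
  fixes \<psi> :: "'a \<Rightarrow> 'w \<Rightarrow> 'b::{real_normed_vector, heine_borel}"
  assumes U: "free_ultrafilter U" and x: "\<And>n. norm (x n) \<le> B" and "locally_bounded \<psi>"
  shows "((\<lambda>n. \<psi> (v + scl c (x n)) w) \<longlongrightarrow> Lim U (\<lambda>n. \<psi> (v + scl c (x n)) w)) U"
proof (rule free_ultrafilter_tendsto[OF U])
  obtain \<beta> where \<beta>: "\<And>u. norm u \<le> norm v + norm c * B \<Longrightarrow> norm (\<psi> u w) \<le> \<beta>"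
    using assms(3) unfolding locally_bounded_def by meson
  have "norm (v + scl c (x n)) \<le> norm v + norm c * B" for n
    using norm_triangle_ineq[of v "scl c (x n)"] mult_left_mono[OF x[of n], of "norm c"]
    by (simp add: norm_scale)
  then show "bounded (range (\<lambda>n. \<psi> (v + scl c (x n)) w))"
    unfolding bounded_iff using \<beta> by auto
qed

lemma iterated_lim_locally_bounded:
  fixes \<phi> :: "'a \<Rightarrow> 'w \<Rightarrow> 'b::{real_normed_vector, heine_borel}"
  assumes U: "free_ultrafilter U" and x: "\<And>n. norm (x n) \<le> B" and \<phi>: "locally_bounded \<phi>"
  shows "locally_bounded (iterated_lim U x \<phi> cs)"
proof (induction cs)
  case Nil
  then show ?case using \<phi> by (simp add: locally_bounded_def)
next
  case (Cons c cs)
  show ?case unfolding locally_bounded_def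
  proof (intro allI)
    fix R w
    obtain \<beta> where \<beta>: "\<And>u. norm u \<le> R + norm c * B \<Longrightarrow> norm (iterated_lim U x \<phi> cs u w) \<le> \<beta>"
      using Cons.IH unfolding locally_bounded_def by meson
    have "norm (iterated_lim U x \<phi> (c # cs) v w) \<le> \<beta>" if "norm v \<le> R" for v
    proof (rule tendsto_upperbound)
      show "((\<lambda>n. norm (iterated_lim U x \<phi> cs (v + scl c (x n)) w)) \<longlongrightarrow>
          norm (iterated_lim U x \<phi> (c # cs) v w)) U"
        unfolding iterated_lim.simps
        by (intro tendsto_norm locally_bounded_tendsto_Lim[OF U x Cons.IH])
      have "norm (v + scl c (x n)) \<le> R + norm c * B" for n
        using norm_triangle_ineq[of v "scl c (x n)"] mult_left_mono[OF x[of n], of "norm c"] that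
        by (simp add: norm_scale)
      then show "\<forall>\<^sub>F n in U. norm (iterated_lim U x \<phi> cs (v + scl c (x n)) w) \<le> \<beta>"
        using \<beta> by (intro always_eventually) blast
      show "U \<noteq> bot" using U by (simp add: free_ultrafilter_def)
    qed
    then show "\<exists>\<beta>. \<forall>v. norm v \<le> R \<longrightarrow> norm (iterated_lim U x \<phi> (c # cs) v w) \<le> \<beta>" by blast
  qed
qed

lemma iterated_lim_tendsto:
  fixes \<phi> :: "'a \<Rightarrow> 'w \<Rightarrow> 'b::{real_normed_vector, heine_borel}"
  assumes "free_ultrafilter U" "\<And>n. norm (x n) \<le> B" "locally_bounded \<phi>"
  shows "((\<lambda>n. iterated_lim U x \<phi> cs (v + scl c (x n)) w) \<longlongrightarrow> iterated_lim U x \<phi> (c # cs) v w) U"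
  unfolding iterated_lim.simps
  by (rule locally_bounded_tendsto_Lim[OF assms(1,2) iterated_lim_locally_bounded[OF assms]])

lemma locally_bounded_norming: "locally_bounded norming"
  unfolding locally_bounded_def using dual_ballD(3)[OF norming(1)] by blast

lemma iterated_lim_norming_dual_ball:
  assumes U: "free_ultrafilter U" and x: "\<And>n. norm (x n) \<le> B"
  shows "iterated_lim U x norming cs v \<in> dual_ball"
proof (induction cs arbitrary: v)
  case Nil
  have "iterated_lim U x norming [] v = norming v" by (simp add: fun_eq_iff)
  then show ?case using norming by simp
next
  case (Cons c cs)
  let ?T = "\<lambda>n. iterated_lim U x norming cs (v + scl c (x n))"
  let ?L = "iterated_lim U x norming (c # cs) v"
  have lim: "((\<lambda>n. ?T n w) \<longlongrightarrow> ?L w) U" for w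
    by (rule iterated_lim_tendsto[OF U x locally_bounded_norming])
  have nt: "U \<noteq> bot" using U by (simp add: free_ultrafilter_def)
  have "?L (u + w) = ?L u + ?L w" for u w
    using tendsto_add[OF lim lim, of u w] lim[of "u + w"]
    by (intro tendsto_unique[OF nt]) (simp_all add: dual_ballD(1)[OF Cons.IH])
  moreover have "?L (scl d w) = d * ?L w" for d w
    using tendsto_mult_left[OF lim, of d w] lim[of "scl d w"]
    by (intro tendsto_unique[OF nt]) (simp_all add: dual_ballD(2)[OF Cons.IH])
  moreover have "norm (?L w) \<le> norm w" for w
    using dual_ballD(3)[OF Cons.IH]
    by (intro tendsto_upperbound[OF tendsto_norm[OF lim] _ nt] always_eventually) auto
  ultimately show ?case by (simp add: dual_ball_def del: iterated_lim.simps)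
qed

end

text \<open>
  A subsequence can be chosen term by term so that each term meets a condition that depends on the
  earlier terms only, as long as the condition holds for almost all candidates. A single ultrafilter
  makes finitely many such conditions compatible.
\<close>
lemma subsequence_selection:
  assumes "U \<noteq> bot" "U \<le> sequentially"
    and ev: "\<And>r t. eventually (C r t) U"
    and prefix: "\<And>r r' t. (\<And>s. s < t \<Longrightarrow> r s = r' s) \<Longrightarrow> C r t = C r' t"
  obtains r :: "nat \<Rightarrow> nat" where "strict_mono r" "\<And>t. C r t (r t)"
proof -
  let ?P = "\<lambda>r t n. C r t n \<and> (\<forall>s<t. r s < n)"
  have "\<exists>r. \<forall>t. ?P r t (r t)"
  proof (rule dependent_wf_choice[OF wf_less])
    show "?P f t n = ?P g t n"
      if "\<And>z. (z, t) \<in> {(x, y). x < y} \<Longrightarrow> f z = g z" for f g :: "nat \<Rightarrow> nat" and t n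
      using prefix[of t f g] that by auto
    show "\<exists>n. ?P r t n" for t r
    proof -
      have "\<forall>\<^sub>F n in sequentially. \<forall>s\<in>{..<t}. r s < n"
        by (intro eventually_ball_finite ballI eventually_gt_at_top) auto
      then have "\<forall>\<^sub>F n in U. \<forall>s\<in>{..<t}. r s < n" using assms(2) by (simp add: filter_leD)
      with ev[of r t] have "\<forall>\<^sub>F n in U. ?P r t n" by eventually_elim auto
      then show ?thesis using assms(1) eventually_happens' by blast
    qed
  qed
  then obtain r where r: "\<And>t. ?P r t (r t)" by blast
  then have "strict_mono r" by (intro strict_monoI) auto
  with r show thesis using that by blast
qed

lemma unit_ball_nets:
  fixes \<eta> :: "nat \<Rightarrow> real"
  assumes "\<And>t. 0 < \<eta> t"
  obtains Q :: "nat \<Rightarrow> 'k::euclidean_space set"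
  where "\<And>t. finite (Q t)" "\<And>t. 0 \<in> Q t" "mono Q"
    "\<And>a t. norm a \<le> 1 \<Longrightarrow> \<exists>q\<in>Q t. norm (a - q) < \<eta> t"
proof -
  have "\<exists>K. finite K \<and> cball (0::'k) 1 \<subseteq> (\<Union>q\<in>K. ball q (\<eta> t))" for t
    using compact_cball assms unfolding compact_eq_totally_bounded by blast
  then obtain K where K: "\<And>t. finite (K t)" "\<And>t. cball (0::'k) 1 \<subseteq> (\<Union>q\<in>K t. ball q (\<eta> t))"
    by metis
  let ?Q = "\<lambda>t. insert 0 (\<Union>s\<le>t. K s)"
  show thesis
  proof (rule that[of ?Q])
    show "mono ?Q" unfolding mono_def by (meson UN_mono atMost_subset_iff insert_mono order_refl)
    show "\<exists>q\<in>?Q t. norm (a - q) < \<eta> t" if "norm a \<le> 1" for a :: 'k and t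
    proof -
      have "a \<in> cball 0 1" using that by simp
      then obtain q where "q \<in> K t" "a \<in> ball q (\<eta> t)" using K(2)[of t] by blast
      then show ?thesis by (intro bexI[of _ q]) (auto simp: dist_norm norm_minus_commute)
    qed
  qed (use K(1) in auto)
qed

lemma sum_half_powers_le: "finite A \<Longrightarrow> (\<Sum>i\<in>A. 1 / 2 ^ i) \<le> (2::real)"
proof -
  assume "finite A"
  then have "(\<Sum>i\<in>A. (1/2) ^ i) \<le> (\<Sum>i. (1/2::real) ^ i)"
    by (intro sum_le_suminf summable_geometric) auto
  also have "\<dots> = 2" by (simp add: suminf_geometric)
  finally show ?thesis by (simp add: power_one_over)
qed

context banach_space_over
begin

text \<open>
  At stage \<open>t\<close> there are only finitely many states: a vector \<open>\<Sum>i<t. c i x (r i)\<close> with coefficients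
  in the finite set \<open>Q t\<close>, and a list of at most \<open>M t\<close> further coefficients still to be placed. The
  term \<open>x (r t)\<close> is chosen such that, in every state, placing the next coefficient at \<open>t\<close> changes the
  iterated limit by at most \<open>\<theta> / 2^t\<close>, when tested on \<open>0\<close> and on the terms chosen before.

  For a finite set \<open>E\<close> of positions with coefficients \<open>c\<close>, walk through the stages: the part of \<open>E\<close>
  below \<open>t\<close> has been placed and the part in \<open>{t..}\<close> has not. A stage outside \<open>E\<close> leaves the state alone,
  and a stage in \<open>E\<close> costs \<open>\<theta> / 2^t\<close>. Summing up, the value of \<open>\<phi>\<close> at the complete vector is close to
  the iterated limit in the state at stage \<open>t\<close>. The predicate \<open>P\<close> allows for further demands on
  the chosen term in each state. The test vector \<open>0\<close> serves functions \<open>\<phi>\<close> of their first argument only.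
\<close>
lemma tree_selection:
  fixes \<phi> :: "'a \<Rightarrow> 'a \<Rightarrow> 'b::{real_normed_vector, heine_borel}" and \<theta> :: real
  assumes U: "free_ultrafilter U" and x: "\<And>n. norm (x n) \<le> B" and \<phi>: "locally_bounded \<phi>"
    and Q: "\<And>t. finite (Q t)" "\<And>t. 0 \<in> Q t" "mono Q" and M: "mono M" and "0 < \<theta>"
    and P: "\<And>cs v t. eventually (P cs v t) U"
  shows "\<exists>r. strict_mono r \<and>
    (\<forall>E c t. finite E \<longrightarrow> c ` E \<subseteq> Q t \<longrightarrow> card (E \<inter> {t..}) \<le> M t \<longrightarrow>
      P (map c (sorted_list_of_set (E \<inter> {t..}))) (\<Sum>i\<in>E \<inter> {..<t}. scl (c i) (x (r i))) t (r t)) \<and>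
    (\<forall>E c t w. finite E \<longrightarrow> c ` E \<subseteq> Q t \<longrightarrow> card (E \<inter> {t..}) \<le> M t \<longrightarrow>
        w \<in> insert 0 ((\<lambda>s. x (r s)) ` {..<t}) \<longrightarrow>
      norm (\<phi> (\<Sum>i\<in>E. scl (c i) (x (r i))) w
        - iterated_lim U x \<phi> (map c (sorted_list_of_set (E \<inter> {t..})))
            (\<Sum>i\<in>E \<inter> {..<t}. scl (c i) (x (r i))) w) \<le> 2 * \<theta> / 2 ^ t)"
proof -
  let ?T = "iterated_lim U x \<phi>"
  define D where "D cs v w t n \<longleftrightarrow>
    (\<forall>d ds. cs = d # ds \<longrightarrow> norm (?T ds (v + scl d (x n)) w - ?T cs v w) < \<theta> / 2 ^ t)"
    for cs v w and t n :: nat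
  define C where "C r t n \<longleftrightarrow> (\<forall>cs\<in>{cs. set cs \<subseteq> Q t \<and> length cs \<le> M t}.
    \<forall>c\<in>PiE {..<t} (\<lambda>_. Q t).
      P cs (\<Sum>i<t. scl (c i) (x (r i))) t n \<and>
      (\<forall>w\<in>insert 0 ((\<lambda>s. x (r s)) ` {..<t}). D cs (\<Sum>i<t. scl (c i) (x (r i))) w t n))"
    for r :: "nat \<Rightarrow> nat" and t n
  have evD: "\<forall>\<^sub>F n in U. D cs v w t n" for cs v w t
  proof (cases cs)
    case Nil
    then show ?thesis by (simp add: D_def)
  next
    case (Cons d ds)
    have "\<forall>\<^sub>F n in U. dist (?T ds (v + scl d (x n)) w) (?T (d # ds) v w) < \<theta> / 2 ^ t"
      using \<open>0 < \<theta>\<close> by (intro tendstoD iterated_lim_tendsto[OF U x \<phi>]) simp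
    with Cons show ?thesis by (simp add: D_def dist_norm)
  qed
  have "\<forall>\<^sub>F n in U. C r t n" for r t
    unfolding C_def
    by (intro eventually_ball_finite ballI eventually_conj P evD finite_lists_length_le finite_PiE)
       (auto simp: Q)
  moreover have "C r t = C r' t" if "\<And>s. s < t \<Longrightarrow> r s = r' s" for r r' t
  proof -
    have "(\<Sum>i<t. scl (c i) (x (r i))) = (\<Sum>i<t. scl (c i) (x (r' i)))" for c
      using that by (intro sum.cong) auto
    moreover have "(\<lambda>s. x (r s)) ` {..<t} = (\<lambda>s. x (r' s)) ` {..<t}"
      using that by (intro image_cong) auto
    ultimately show ?thesis by (simp add: C_def fun_eq_iff)
  qed
  ultimately obtain r where r: "strict_mono r" "\<And>t. C r t (r t)"
    using subsequence_selection[of U C] U unfolding free_ultrafilter_def by metis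
  let ?cs = "\<lambda>E c t. map c (sorted_list_of_set (E \<inter> {t..}))"
  let ?v = "\<lambda>E c t. \<Sum>i\<in>E \<inter> {..<t}. scl (c i) (x (r i))"
  let ?W = "\<lambda>t. insert 0 ((\<lambda>s. x (r s)) ` {..<t})"
  have good: "P (?cs E c t) (?v E c t) t (r t)"
      "w \<in> ?W t \<Longrightarrow> D (?cs E c t) (?v E c t) w t (r t)"
    if "finite E" "c ` E \<subseteq> Q t" "card (E \<inter> {t..}) \<le> M t" for E c t w
  proof -
    let ?c = "restrict (\<lambda>i. if i \<in> E then c i else 0) {..<t}"
    have cs: "?cs E c t \<in> {cs. set cs \<subseteq> Q t \<and> length cs \<le> M t}"
      using that by auto
    have c: "?c \<in> PiE {..<t} (\<lambda>_. Q t)"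
      using that(2) Q(2) by (auto simp: PiE_iff)
    have v: "?v E c t = (\<Sum>i<t. scl (?c i) (x (r i)))"
    proof -
      have "?v E c t = (\<Sum>i\<in>{..<t} \<inter> E. scl (c i) (x (r i)))" by (simp add: Int_commute)
      also have "\<dots> = (\<Sum>i<t. if i \<in> E then scl (c i) (x (r i)) else 0)"
        by (rule sum.inter_restrict) simp
      also have "\<dots> = (\<Sum>i<t. scl (?c i) (x (r i)))" by (intro sum.cong) auto
      finally show ?thesis .
    qed
    from r(2)[of t, unfolded C_def, THEN bspec, OF cs, THEN bspec, OF c]
    show "P (?cs E c t) (?v E c t) t (r t)"
      "w \<in> ?W t \<Longrightarrow> D (?cs E c t) (?v E c t) w t (r t)"
      unfolding v by blast+
  qed
  have step_le: "norm (?T (?cs E c (Suc t)) (?v E c (Suc t)) w - ?T (?cs E c t) (?v E c t) w) \<le> \<theta> / 2 ^ t"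
    if *: "finite E" "c ` E \<subseteq> Q t" "card (E \<inter> {t..}) \<le> M t" and w: "w \<in> ?W t" for E c t w
  proof (cases "t \<in> E")
    case True
    have "Min (E \<inter> {t..}) = t" using True that(1) by (intro Min_eqI) auto
    moreover have "E \<inter> {t..} - {t} = E \<inter> {Suc t..}" by auto
    ultimately have "?cs E c t = c t # ?cs E c (Suc t)"
      using True that(1) by (subst sorted_list_of_set_nonempty) auto
    moreover have "E \<inter> {..<Suc t} = insert t (E \<inter> {..<t})" using True by auto
    then have "?v E c (Suc t) = ?v E c t + scl (c t) (x (r t))"
      using that(1) by (simp add: add.commute)
    ultimately show ?thesis
      using good(2)[OF * w] unfolding D_def by (simp del: iterated_lim.simps)
  next
    case False
    then have "E \<inter> {..<Suc t} = E \<inter> {..<t}" "E \<inter> {Suc t..} = E \<inter> {t..}"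
      by (auto simp: less_Suc_eq Suc_le_eq le_less)
    then show ?thesis using \<open>0 < \<theta>\<close> by simp
  qed
  have "norm (\<phi> (\<Sum>i\<in>E. scl (c i) (x (r i))) w - ?T (?cs E c t) (?v E c t) w) \<le> 2 * \<theta> / 2 ^ t"
    if *: "finite E" "c ` E \<subseteq> Q t" "card (E \<inter> {t..}) \<le> M t" and w: "w \<in> ?W t" for E c t w
  proof -
    have tele: "norm (?T (?cs E c n) (?v E c n) w - ?T (?cs E c t) (?v E c t) w)
        \<le> 2 * \<theta> / 2 ^ t - 2 * \<theta> / 2 ^ n" if "t \<le> n" for n
      using that
    proof (induction n rule: dec_induct)
      case (step n)
      have "c ` E \<subseteq> Q n" using *(2) monoD[OF Q(3) step(1)] by blast
      moreover have "card (E \<inter> {n..}) \<le> M n"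
      proof -
        have "card (E \<inter> {n..}) \<le> card (E \<inter> {t..})"
          using *(1) step(1) by (intro card_mono) auto
        also have "\<dots> \<le> M n" using *(3) monoD[OF M step(1)] by simp
        finally show ?thesis .
      qed
      moreover have "w \<in> ?W n" using w step(1) by auto
      ultimately have "norm (?T (?cs E c (Suc n)) (?v E c (Suc n)) w - ?T (?cs E c n) (?v E c n) w)
          \<le> \<theta> / 2 ^ n"
        using step_le *(1) by blast
      moreover have "2 * \<theta> / 2 ^ Suc n = \<theta> / 2 ^ n" "2 * \<theta> / 2 ^ n = \<theta> / 2 ^ n + \<theta> / 2 ^ n" by simp_all
      ultimately show ?case using norm_diff_triangle_le[OF _ step.IH] by fastforce
    qed simp
    obtain n where n: "E \<subseteq> {..<n}" using *(1) finite_nat_iff_bounded by auto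
    let ?n = "max t n"
    have "E \<inter> {?n..} = {}" "E \<inter> {..<?n} = E" using n by auto
    then have "norm (\<phi> (\<Sum>i\<in>E. scl (c i) (x (r i))) w - ?T (?cs E c t) (?v E c t) w)
        \<le> 2 * \<theta> / 2 ^ t - 2 * \<theta> / 2 ^ ?n"
      using tele[of ?n] by simp
    also have "\<dots> \<le> 2 * \<theta> / 2 ^ t" using \<open>0 < \<theta>\<close> by simp
    finally show ?thesis .
  qed
  with r(1) good(1) show ?thesis by (intro exI[of _ r] conjI allI impI)
qed

section \<open>Suppressing all but few coordinates outside an initial segment\<close>
lemma norm_sum_scl_diff_le:
  assumes "\<And>i. i \<in> A \<Longrightarrow> norm (a i - c i) \<le> \<eta>" "\<And>i. i \<in> A \<Longrightarrow> norm (v i) \<le> B" "0 \<le> B" "0 \<le> \<eta>"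
  shows "norm ((\<Sum>i\<in>A. scl (a i) (v i)) - (\<Sum>i\<in>A. scl (c i) (v i))) \<le> real (card A) * (\<eta> * B)"
proof -
  have "(\<Sum>i\<in>A. scl (a i) (v i)) - (\<Sum>i\<in>A. scl (c i) (v i)) = (\<Sum>i\<in>A. scl (a i - c i) (v i))"
    by (simp add: sum_subtractf scale_left_diff_distrib)
  also have "norm \<dots> \<le> real (card A) * (\<eta> * B)"
    using assms by (intro sum_norm_bound) (simp add: norm_scale mult_mono)
  finally show ?thesis .
qed

lemma seminormalizedE:
  assumes "seminormalized (x :: nat \<Rightarrow> 'a)"
  obtains b B where "0 < b" "0 < B" "\<And>n. b \<le> norm (x n)" "\<And>n. norm (x n) \<le> B"
proof
  let ?b = "INF n. norm (x n)" and ?B = "SUP n. norm (x n)"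
  show "0 < ?b" using assms by (simp add: seminormalized_def)
  show b: "?b \<le> norm (x n)" for n
    by (intro cINF_lower bdd_belowI2[of _ 0]) auto
  show B: "norm (x n) \<le> ?B" for n
    using assms by (intro cSUP_upper) (auto simp: seminormalized_def)
  show "0 < ?B" using \<open>0 < ?b\<close> b[of 0] B[of 0] by linarith
qed

text \<open>
  Let \<open>E\<close> consist of an initial part of \<open>G\<close> and of the set \<open>F\<close>, and let \<open>g\<close> norm the part of the vector
  supported on \<open>E\<close>, after rounding its coefficients to a net. For an index \<open>t\<close> of \<open>G\<close> outside \<open>E\<close>,
  compare \<open>g\<close> with the iterated limit functional in the state at stage \<open>t\<close>. That functional was
  available before \<open>x (r t)\<close> was chosen, so by weak nullness \<open>x (r t)\<close> could be taken where
  it is small; and \<open>g\<close> is close to it at \<open>x (r t)\<close>, as later stages respect the terms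
  already chosen. Hence \<open>g\<close> nearly vanishes at the terms outside \<open>E\<close>, and evaluating \<open>g\<close> at the full
  vector gives the bound. The error is additive, so coefficients are at most \<open>1\<close> here.
\<close>
lemma schreier_suppression_additive:
  fixes M :: "nat \<Rightarrow> nat"
  assumes wn: "weakly_null scl x" and x: "\<And>n. norm (x n) \<le> B" and "0 < B" and "0 < \<tau>"
  shows "\<exists>r. strict_mono r \<and> (\<forall>G F j a.
      finite G \<longrightarrow> F \<subseteq> G \<inter> {j..} \<longrightarrow> card F \<le> M j \<longrightarrow> (\<forall>i\<in>G. norm (a i) \<le> 1) \<longrightarrow>
      norm (\<Sum>i\<in>(G \<inter> {..<j}) \<union> F. scl (a i) (x (r i)))
        \<le> norm (\<Sum>i\<in>G. scl (a i) (x (r i))) + \<tau>)"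
proof -
  obtain U where U: "free_ultrafilter U" using free_ultrafilter_exists by blast
  \<comment> \<open>Rounding costs \<open>2 * \<theta>\<close> (once in the norm, once under \<open>g\<close>), and the terms outside \<open>E\<close> cost \<open>4 * \<theta>\<close>.\<close>
  define \<theta> where "\<theta> = \<tau> / 6"
  have "0 < \<theta>" using \<open>0 < \<tau>\<close> by (simp add: \<theta>_def)
  define M' where "M' t = (\<Sum>i\<le>t. M i)" for t
  define \<eta> where "\<eta> t = \<theta> / ((real t + real (M' t) + 1) * B)" for t
  have \<eta>: "0 < \<eta> t" for t
    using \<open>0 < \<theta>\<close> \<open>0 < B\<close> by (simp add: \<eta>_def divide_pos_pos mult_pos_pos add_nonneg_pos)
  obtain Q :: "nat \<Rightarrow> 'k set" where Q: "\<And>t. finite (Q t)" "\<And>t. 0 \<in> Q t" "mono Q"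
    and net: "\<And>a t. norm a \<le> 1 \<Longrightarrow> \<exists>q\<in>Q t. norm (a - q) < \<eta> t"
    using unit_ball_nets[of \<eta>] \<eta> by metis
  have M': "mono M'" unfolding M'_def by (intro monoI sum_mono2) auto
  let ?T = "iterated_lim U x norming"
  have evP: "\<forall>\<^sub>F n in U. norm (?T cs v (x n)) < \<theta> / 2 ^ t" for cs v t
  proof -
    have "(\<lambda>n. ?T cs v (x n)) \<longlonglongrightarrow> 0"
      by (rule dual_ball_weakly_null[OF iterated_lim_norming_dual_ball[OF U x] wn])
    then have "\<forall>\<^sub>F n in sequentially. dist (?T cs v (x n)) 0 < \<theta> / 2 ^ t"
      using \<open>0 < \<theta>\<close> by (intro tendstoD) auto
    then show ?thesis using U by (auto simp: free_ultrafilter_def intro: filter_leD)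
  qed
  obtain r where r: "strict_mono r"
    and small: "\<forall>E c t. finite E \<longrightarrow> c ` E \<subseteq> Q t \<longrightarrow> card (E \<inter> {t..}) \<le> M' t \<longrightarrow>
      norm (?T (map c (sorted_list_of_set (E \<inter> {t..})))
        (\<Sum>i\<in>E \<inter> {..<t}. scl (c i) (x (r i))) (x (r t))) < \<theta> / 2 ^ t"
    and close: "\<forall>E c t w. finite E \<longrightarrow> c ` E \<subseteq> Q t \<longrightarrow> card (E \<inter> {t..}) \<le> M' t \<longrightarrow>
        w \<in> insert 0 ((\<lambda>s. x (r s)) ` {..<t}) \<longrightarrow>
      norm (norming (\<Sum>i\<in>E. scl (c i) (x (r i))) w
        - ?T (map c (sorted_list_of_set (E \<inter> {t..})))
            (\<Sum>i\<in>E \<inter> {..<t}. scl (c i) (x (r i))) w) \<le> 2 * \<theta> / 2 ^ t"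
    using tree_selection[where x = x and P = "\<lambda>cs v t n. norm (?T cs v (x n)) < \<theta> / 2 ^ t"
        and M = M', OF U x locally_bounded_norming Q M' \<open>0 < \<theta>\<close> evP]
    by (elim exE conjE) (erule (2) that)
  note small = small[rule_format] and close = close[rule_format]
  \<comment> \<open>Since \<open>t\<close> is not in \<open>E\<close>, the states at the stages \<open>t\<close> and \<open>Suc t\<close> agree; at stage \<open>Suc t\<close> the term
    \<open>x (r t)\<close> is already a test vector.\<close>
  have off: "norm (norming (\<Sum>i\<in>E. scl (c i) (x (r i))) (x (r t))) \<le> 2 * \<theta> / 2 ^ t"
    if E: "finite E" "c ` E \<subseteq> Q j" "card (E \<inter> {j..}) \<le> M' j" and t: "j \<le> t" "t \<notin> E" for E c j t
  proof -
    have Qt: "c ` E \<subseteq> Q t'" and card: "card (E \<inter> {t'..}) \<le> M' t'" if "j \<le> t'" for t'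
    proof -
      show "c ` E \<subseteq> Q t'" using E(2) monoD[OF Q(3) that] by blast
      have "card (E \<inter> {t'..}) \<le> card (E \<inter> {j..})" using E(1) that by (intro card_mono) auto
      also have "\<dots> \<le> M' t'" using E(3) monoD[OF M' that] by simp
      finally show "card (E \<inter> {t'..}) \<le> M' t'" .
    qed
    have same: "E \<inter> {..<Suc t} = E \<inter> {..<t}" "E \<inter> {Suc t..} = E \<inter> {t..}"
      using t(2) by (auto simp: less_Suc_eq Suc_le_eq le_less)
    have "norm (norming (\<Sum>i\<in>E. scl (c i) (x (r i))) (x (r t))
        - ?T (map c (sorted_list_of_set (E \<inter> {t..})))
            (\<Sum>i\<in>E \<inter> {..<t}. scl (c i) (x (r i))) (x (r t))) \<le> 2 * \<theta> / 2 ^ Suc t"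
      using close[OF E(1) Qt card, of "Suc t" "x (r t)"] t(1) by (simp add: same)
    moreover note small[OF E(1) Qt card, OF t(1) t(1)]
    moreover have "2 * \<theta> / 2 ^ Suc t = \<theta> / 2 ^ t" "2 * \<theta> / 2 ^ t = \<theta> / 2 ^ t + \<theta> / 2 ^ t" by simp_all
    ultimately show ?thesis
      using norm_triangle_sub[of "norming (\<Sum>i\<in>E. scl (c i) (x (r i))) (x (r t))"
          "?T (map c (sorted_list_of_set (E \<inter> {t..}))) (\<Sum>i\<in>E \<inter> {..<t}. scl (c i) (x (r i))) (x (r t))"]
      by linarith
  qed
  show ?thesis
  proof (intro exI[of _ r] conjI r allI impI)
    fix G F :: "nat set" and j and a :: "nat \<Rightarrow> 'k"
    assume G: "finite G" and F: "F \<subseteq> G \<inter> {j..}" and cF: "card F \<le> M j"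
      and a: "\<forall>i\<in>G. norm (a i) \<le> 1"
    define E where "E = (G \<inter> {..<j}) \<union> F"
    have EG: "E \<subseteq> G" and finE: "finite E" and finF: "finite F"
      using F G by (auto simp: E_def intro: finite_subset)
    have "E \<inter> {j..} = F" using F by (auto simp: E_def)
    have "card F \<le> M' j" using cF member_le_sum[of j "{..j}" M] by (simp add: M'_def)
    with \<open>E \<inter> {j..} = F\<close> have cE: "card (E \<inter> {j..}) \<le> M' j" by simp
    have "card E \<le> card (G \<inter> {..<j}) + card F" unfolding E_def by (rule card_Un_le)
    also have "card (G \<inter> {..<j}) \<le> card {..<j}" by (intro card_mono) auto
    finally have cardE: "card E \<le> j + M' j" using \<open>card F \<le> M' j\<close> by simp
    have "\<forall>i\<in>E. \<exists>q\<in>Q j. norm (a i - q) < \<eta> j" using a EG net by blast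
    then obtain c where c: "\<And>i. i \<in> E \<Longrightarrow> c i \<in> Q j" "\<And>i. i \<in> E \<Longrightarrow> norm (a i - c i) < \<eta> j"
      by metis
    let ?S = "\<lambda>a A. \<Sum>i\<in>A. scl (a i) (x (r i))"
    define g where "g = norming (?S c E)"
    have g: "g \<in> dual_ball" "norm (g (?S c E)) = norm (?S c E)" by (simp_all add: g_def norming)
    have err: "norm (?S a E - ?S c E) \<le> \<theta>"
    proof -
      have "norm (?S a E - ?S c E) \<le> real (card E) * (\<eta> j * B)"
        using c(2) x \<open>0 < B\<close> \<eta> by (intro norm_sum_scl_diff_le) (auto intro: less_imp_le)
      also have "\<dots> \<le> (real j + real (M' j) + 1) * (\<eta> j * B)"
        using cardE \<open>0 < B\<close> \<eta>[of j] by (intro mult_right_mono) auto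
      also have "\<dots> = \<theta>"
      proof -
        have "real j + real (M' j) + 1 > 0" by simp
        then show ?thesis using \<open>0 < B\<close> by (simp add: \<eta>_def)
      qed
      finally show ?thesis .
    qed
    have tail: "norm (g (?S a (G - E))) \<le> 4 * \<theta>"
    proof -
      have "norm (g (?S a (G - E))) = norm (\<Sum>i\<in>G - E. a i * g (x (r i)))"
        by (simp add: dual_ball_sum[OF g(1)])
      also have "\<dots> \<le> (\<Sum>i\<in>G - E. 2 * \<theta> * (1 / 2 ^ i))"
      proof (rule sum_norm_le)
        fix i assume i: "i \<in> G - E"
        then have "j \<le> i" by (auto simp: E_def)
        then have "norm (g (x (r i))) \<le> 2 * \<theta> / 2 ^ i"
          unfolding g_def using i c(1) by (intro off[OF finE _ cE]) auto
        moreover have "norm (a i) \<le> 1" using a i by simp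
        ultimately show "norm (a i * g (x (r i))) \<le> 2 * \<theta> * (1 / 2 ^ i)"
          using mult_mono[of "norm (a i)" 1 "norm (g (x (r i)))" "2 * \<theta> / 2 ^ i"]
          by (simp add: norm_mult)
      qed
      also have "\<dots> = 2 * \<theta> * (\<Sum>i\<in>G - E. 1 / 2 ^ i)" by (rule sum_distrib_left[symmetric])
      also have "\<dots> \<le> 2 * \<theta> * 2"
        using G \<open>0 < \<theta>\<close> by (intro mult_left_mono sum_half_powers_le) auto
      finally show ?thesis by simp
    qed
    have "?S a G = ?S a E + ?S a (G - E)"
      using sum.subset_diff[OF EG G, of "\<lambda>i. scl (a i) (x (r i))"] by (simp add: add.commute)
    then have "g (?S a G) = g (?S a E) + g (?S a (G - E))"
      by (simp add: dual_ballD[OF g(1)])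
    moreover have "g (?S a E) = g (?S c E) + g (?S a E - ?S c E)"
      using dual_ballD(1)[OF g(1), of "?S c E" "?S a E - ?S c E"] by simp
    ultimately have "g (?S c E) = g (?S a G) - g (?S a (G - E)) - g (?S a E - ?S c E)"
      by simp
    then have "norm (?S c E)
        \<le> norm (g (?S a G)) + norm (g (?S a (G - E))) + norm (g (?S a E - ?S c E))"
      using g(2) norm_triangle_ineq4[of "g (?S a G) - g (?S a (G - E))" "g (?S a E - ?S c E)"]
        norm_triangle_ineq4[of "g (?S a G)" "g (?S a (G - E))"] by simp
    also have "\<dots> \<le> norm (?S a G) + 4 * \<theta> + \<theta>"
      using dual_ballD(3)[OF g(1)] err by (intro add_mono tail) (auto intro: order_trans)
    finally have "norm (?S a E) \<le> norm (?S a G) + 6 * \<theta>"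
      using err norm_triangle_sub[of "?S a E" "?S c E"] by linarith
    then show "norm (\<Sum>i\<in>(G \<inter> {..<j}) \<union> F. scl (a i) (x (r i)))
        \<le> norm (\<Sum>i\<in>G. scl (a i) (x (r i))) + \<tau>"
      by (simp add: E_def \<theta>_def)
  qed
qed

text \<open>
  A sharpened form of Odell's theorem on Schreier unconditional sequences: the retained set may
  contain a whole initial segment, its remaining part may be as large as any prescribed
  function of where it begins, and the constant is close to \<open>1\<close>. It follows from the additive form by
  scaling the largest coefficient to \<open>1\<close>. Applying the additive form to the singleton of
  that coefficient bounds it by a multiple of the norm, which absorbs the additive error.
\<close>
theorem schreier_suppression:
  fixes M :: "nat \<Rightarrow> nat"
  assumes wn: "weakly_null scl x" and sn: "seminormalized x" and "0 < \<epsilon>"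
  shows "\<exists>r. strict_mono r \<and> (\<forall>G F j a.
      finite G \<longrightarrow> F \<subseteq> G \<inter> {j..} \<longrightarrow> card F \<le> M j \<longrightarrow>
      norm (\<Sum>i\<in>(G \<inter> {..<j}) \<union> F. scl (a i) (x (r i)))
        \<le> (1 + \<epsilon>) * norm (\<Sum>i\<in>G. scl (a i) (x (r i))))"
proof -
  obtain b B where b: "0 < b" "\<And>n. b \<le> norm (x n)" and B: "0 < B" "\<And>n. norm (x n) \<le> B"
    using seminormalizedE[OF sn] by metis
  define \<tau> where "\<tau> = min 1 \<epsilon> * b / 2"
  have \<tau>: "0 < \<tau>" "\<tau> \<le> b / 2" "\<tau> \<le> \<epsilon> * b / 2"
    using \<open>0 < b\<close> \<open>0 < \<epsilon>\<close> by (auto simp: \<tau>_def)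
  \<comment> \<open>The lower bound \<open>1\<close> makes singletons admissible at \<open>j = 0\<close>.\<close>
  let ?M = "\<lambda>j. max 1 (M j)"
  obtain r where r: "strict_mono r"
    and add: "\<forall>G F j a.
      finite G \<longrightarrow> F \<subseteq> G \<inter> {j..} \<longrightarrow> card F \<le> ?M j \<longrightarrow> (\<forall>i\<in>G. norm (a i) \<le> 1) \<longrightarrow>
      norm (\<Sum>i\<in>(G \<inter> {..<j}) \<union> F. scl (a i) (x (r i)))
        \<le> norm (\<Sum>i\<in>G. scl (a i) (x (r i))) + \<tau>"
    using schreier_suppression_additive[where M = ?M, OF wn B(2) B(1) \<tau>(1)]
    by (elim exE conjE) (erule (1) that)
  note add = add[rule_format]
  show ?thesis
  proof (intro exI[of _ r] conjI r allI impI)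
    fix G F :: "nat set" and j and a :: "nat \<Rightarrow> 'k"
    assume G: "finite G" and F: "F \<subseteq> G \<inter> {j..}" and cF: "card F \<le> M j"
    let ?S = "\<lambda>a A. \<Sum>i\<in>A. scl (a i) (x (r i))"
    let ?N = "norm (?S a G)"
    show "norm (?S a ((G \<inter> {..<j}) \<union> F)) \<le> (1 + \<epsilon>) * ?N"
    proof (cases "\<forall>i\<in>G. a i = 0")
      case True
      then have "?S a ((G \<inter> {..<j}) \<union> F) = 0" using F by (intro sum.neutral) auto
      then show ?thesis using \<open>0 < \<epsilon>\<close> by simp
    next
      case False
      define m where "m = Max ((\<lambda>i. norm (a i)) ` G)"
      have "G \<noteq> {}" using False by auto
      then have "m \<in> (\<lambda>i. norm (a i)) ` G" unfolding m_def using G by (intro Max_in) auto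
      then obtain i0 where i0: "i0 \<in> G" "norm (a i0) = m" by auto
      have le_m: "norm (a i) \<le> m" if "i \<in> G" for i
        unfolding m_def using that G by (intro Max_ge) auto
      obtain i1 where "i1 \<in> G" "a i1 \<noteq> 0" using False by auto
      with le_m[of i1] have "0 < m" by (smt (verit) zero_less_norm_iff)
      have scaled: "norm (?S a ((G \<inter> {..<j}) \<union> F)) \<le> ?N + \<tau> * m"
        if "F \<subseteq> G \<inter> {j..}" "card F \<le> ?M j" for F j
      proof -
        let ?a = "\<lambda>i. a i / of_real m"
        have S: "?S a A = scl (of_real m) (?S ?a A)" for A
          using \<open>0 < m\<close> by (simp add: scale_sum_right)
        have "\<forall>i\<in>G. norm (?a i) \<le> 1"
          using le_m \<open>0 < m\<close> by (auto simp: norm_divide)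
        then have "m * norm (?S ?a ((G \<inter> {..<j}) \<union> F)) \<le> m * (norm (?S ?a G) + \<tau>)"
          using add[OF G that, of ?a] \<open>0 < m\<close> by (intro mult_left_mono) auto
        then show ?thesis
          unfolding S norm_scale using \<open>0 < m\<close> by (simp add: algebra_simps)
      qed
      have "b * m \<le> ?N + \<tau> * m"
      proof -
        have "b * m \<le> norm (?S a {i0})"
          using b(2)[of "r i0"] \<open>0 < m\<close> i0(2) by (simp add: norm_scale mult.commute)
        also have "?S a {i0} = ?S a ((G \<inter> {..<0}) \<union> {i0})" by simp
        also have "norm \<dots> \<le> ?N + \<tau> * m" using i0 by (intro scaled) auto
        finally show ?thesis .
      qed
      moreover have "\<tau> * m \<le> b / 2 * m" using \<tau>(2) \<open>0 < m\<close> by (intro mult_right_mono) auto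
      ultimately have "b * m \<le> 2 * ?N" by (simp add: field_simps)
      then have "\<tau> * m \<le> \<epsilon> * ?N"
      proof -
        assume bm: "b * m \<le> 2 * ?N"
        have "\<tau> * m \<le> \<epsilon> * b / 2 * m" using \<tau>(3) \<open>0 < m\<close> by (intro mult_right_mono) auto
        also have "\<dots> = \<epsilon> / 2 * (b * m)" by simp
        also have "\<dots> \<le> \<epsilon> / 2 * (2 * ?N)" using bm \<open>0 < \<epsilon>\<close> by (intro mult_left_mono) auto
        finally show ?thesis by simp
      qed
      moreover have "norm (?S a ((G \<inter> {..<j}) \<union> F)) \<le> ?N + \<tau> * m"
        using F cF by (intro scaled) auto
      ultimately show ?thesis by (simp add: algebra_simps)
    qed
  qed
qed

end

section \<open>Spreading models\<close>

lemma sorted_list_of_set_strict_mono_image: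
  assumes "strict_mono_on {..<k} (n :: nat \<Rightarrow> nat)"
  shows "sorted_list_of_set (n ` {..<k}) = map n [0..<k]"
proof -
  have "set (map n [0..<k]) = n ` {..<k}" by (auto simp: lessThan_atLeast0)
  moreover have "sorted (map n [0..<k])"
    using assms by (auto simp: sorted_iff_nth_mono le_less strict_mono_onD)
  moreover have "distinct (map n [0..<k])"
    using strict_mono_on_imp_inj_on[OF assms] by (simp add: distinct_map lessThan_atLeast0)
  ultimately show ?thesis by (metis sorted_list_of_set.idem_if_sorted_distinct)
qed

context banach_space_over
begin

text \<open>
  By the selection lemma for \<open>\<phi> v w = norm v\<close>, the norm of a far out combination is close to the
  iterated limit, which depends only on the list of coefficients and not on the positions.
\<close>
lemma asymptotically_stable_subsequence:
  fixes x :: "nat \<Rightarrow> 'a"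
  assumes x: "\<And>n. norm (x n) \<le> B" and "0 < B"
  shows "\<exists>r :: nat \<Rightarrow> nat. strict_mono r \<and> (\<forall>k :: nat. \<forall>e>0. \<exists>m. \<forall>n n' a.
      strict_mono_on {..<k} n \<and> strict_mono_on {..<k} n' \<and> (\<forall>i<k. m \<le> n i \<and> m \<le> n' i) \<and>
      (\<forall>i<k. norm (a i) \<le> 1) \<longrightarrow>
      \<bar>norm (\<Sum>i<k. scl (a i) (x (r (n i)))) - norm (\<Sum>i<k. scl (a i) (x (r (n' i))))\<bar> < e)"
proof -
  obtain U where U: "free_ultrafilter U" using free_ultrafilter_exists by blast
  define \<eta> where "\<eta> t = 1 / (real t + 1)" for t
  have \<eta>: "0 < \<eta> t" for t by (simp add: \<eta>_def)
  obtain Q :: "nat \<Rightarrow> 'k set" where Q: "\<And>t. finite (Q t)" "\<And>t. 0 \<in> Q t" "mono Q"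
    and net: "\<And>a t. norm a \<le> 1 \<Longrightarrow> \<exists>q\<in>Q t. norm (a - q) < \<eta> t"
    using unit_ball_nets[of \<eta>] \<eta> by metis
  let ?\<phi> = "\<lambda>v w :: 'a. norm v"
  have \<phi>: "locally_bounded ?\<phi>" unfolding locally_bounded_def by auto
  let ?T = "iterated_lim U x ?\<phi>"
  have M: "mono (\<lambda>t::nat. t)" by (simp add: mono_def)
  obtain r :: "nat \<Rightarrow> nat" where r: "strict_mono r"
    and close: "\<forall>E c t w. finite E \<longrightarrow> c ` E \<subseteq> Q t \<longrightarrow> card (E \<inter> {t..}) \<le> t \<longrightarrow>
        w \<in> insert 0 ((\<lambda>s. x (r s)) ` {..<t}) \<longrightarrow>
      norm (norm (\<Sum>i\<in>E. scl (c i) (x (r i)))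
        - ?T (map c (sorted_list_of_set (E \<inter> {t..})))
            (\<Sum>i\<in>E \<inter> {..<t}. scl (c i) (x (r i))) w) \<le> 2 * 1 / 2 ^ t"
    using tree_selection[where x = x and P = "\<lambda>_ _ _ _. True" and \<theta> = 1 and B = B,
        OF U x \<phi> Q M zero_less_one always_eventually[OF allI[OF TrueI]]]
    by (elim exE conjE) (erule (1) that)
  note close = close[rule_format]
  show ?thesis
  proof (intro exI[of _ r] conjI r allI impI)
    fix k :: nat and e :: real assume "0 < e"
    have "(\<lambda>m. 2 * (real k * (\<eta> m * B)) + 4 * (1 / 2) ^ m) \<longlonglongrightarrow> 2 * (real k * (0 * B)) + 4 * 0"
    proof (intro tendsto_intros LIMSEQ_power_zero)
      show "\<eta> \<longlonglongrightarrow> 0" unfolding \<eta>_def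
        using LIMSEQ_inverse_real_of_nat by (simp add: inverse_eq_divide add.commute)
    qed auto
    then have "\<forall>\<^sub>F m in sequentially. 2 * (real k * (\<eta> m * B)) + 4 * (1 / 2) ^ m < e"
      using \<open>0 < e\<close> by (intro order_tendstoD(2)) auto
    with eventually_ge_at_top[of k] have "\<forall>\<^sub>F m in sequentially.
        k \<le> m \<and> 2 * (real k * (\<eta> m * B)) + 4 * (1 / 2) ^ m < e"
      by eventually_elim simp
    then obtain m where m: "k \<le> m" "2 * (real k * (\<eta> m * B)) + 4 * (1 / 2) ^ m < e"
      using eventually_happens'[OF sequentially_bot] by blast
    have main: "\<bar>norm (\<Sum>i<k. scl (a i) (x (r (n i)))) - ?T (map q [0..<k]) 0 0\<bar>
        \<le> real k * (\<eta> m * B) + 2 * (1 / 2) ^ m"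
      if n: "strict_mono_on {..<k} n" "\<And>i. i < k \<Longrightarrow> m \<le> n i"
        and q: "\<And>i. i < k \<Longrightarrow> q i \<in> Q m" "\<And>i. i < k \<Longrightarrow> norm (a i - q i) \<le> \<eta> m" for n a q
    proof -
      let ?E = "n ` {..<k}"
      define c where "c = (\<lambda>j. q (the_inv_into {..<k} n j))"
      have inj: "inj_on n {..<k}" by (rule strict_mono_on_imp_inj_on[OF n(1)])
      have c: "c (n i) = q i" if "i < k" for i
        using that inj by (simp add: c_def the_inv_into_f_f)
      have E: "?E \<inter> {m..} = ?E" "?E \<inter> {..<m} = {}" using n(2) by fastforce+
      have "card ?E \<le> m" using m(1) by (simp add: card_image[OF inj])
      moreover have "c ` ?E \<subseteq> Q m" using q(1) c by auto
      ultimately have "norm (norm (\<Sum>i\<in>?E. scl (c i) (x (r i)))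
          - ?T (map c (map n [0..<k])) 0 0) \<le> 2 * 1 / 2 ^ m"
        using close[of ?E c m 0] by (simp add: E sorted_list_of_set_strict_mono_image[OF n(1)])
      moreover have "(\<Sum>i\<in>?E. scl (c i) (x (r i))) = (\<Sum>i<k. scl (q i) (x (r (n i))))"
        using c by (simp add: sum.reindex[OF inj])
      moreover have "map c (map n [0..<k]) = map q [0..<k]" using c by simp
      ultimately have "norm (norm (\<Sum>i<k. scl (q i) (x (r (n i)))) - ?T (map q [0..<k]) 0 0)
          \<le> 2 * 1 / 2 ^ m"
        by (simp only:)
      then have "norm (norm (\<Sum>i<k. scl (q i) (x (r (n i)))) - ?T (map q [0..<k]) 0 0)
          \<le> 2 * (1 / 2) ^ m"
        by (simp add: power_one_over)
      moreover have "norm ((\<Sum>i<k. scl (a i) (x (r (n i)))) - (\<Sum>i<k. scl (q i) (x (r (n i)))))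
          \<le> real (card {..<k}) * (\<eta> m * B)"
        using q(2) x \<open>0 < B\<close> \<eta>[of m] by (intro norm_sum_scl_diff_le) auto
      ultimately show ?thesis
        using norm_triangle_ineq3[of "\<Sum>i<k. scl (a i) (x (r (n i)))" "\<Sum>i<k. scl (q i) (x (r (n i)))"]
        by simp
    qed
    show "\<exists>m. \<forall>n n' a.
      strict_mono_on {..<k} n \<and> strict_mono_on {..<k} n' \<and> (\<forall>i<k. m \<le> n i \<and> m \<le> n' i) \<and>
      (\<forall>i<k. norm (a i) \<le> 1) \<longrightarrow>
      \<bar>norm (\<Sum>i<k. scl (a i) (x (r (n i)))) - norm (\<Sum>i<k. scl (a i) (x (r (n' i))))\<bar> < e"
    proof (intro exI[of _ m] allI impI, elim conjE)
      fix n n' and a :: "nat \<Rightarrow> 'k"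
      assume *: "strict_mono_on {..<k} n" "strict_mono_on {..<k} n'"
        "\<forall>i<k. m \<le> n i \<and> m \<le> n' i" and a: "\<forall>i<k. norm (a i) \<le> 1"
      have "\<forall>i. \<exists>q. i < k \<longrightarrow> q \<in> Q m \<and> norm (a i - q) < \<eta> m" using a net by blast
      then obtain q where q: "\<And>i. i < k \<Longrightarrow> q i \<in> Q m" "\<And>i. i < k \<Longrightarrow> norm (a i - q i) \<le> \<eta> m"
        by (metis less_imp_le)
      have "\<bar>norm (\<Sum>i<k. scl (a i) (x (r (n i)))) - ?T (map q [0..<k]) 0 0\<bar>
          \<le> real k * (\<eta> m * B) + 2 * (1 / 2) ^ m"
        "\<bar>norm (\<Sum>i<k. scl (a i) (x (r (n' i)))) - ?T (map q [0..<k]) 0 0\<bar>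
          \<le> real k * (\<eta> m * B) + 2 * (1 / 2) ^ m"
        by (rule main; use * q in blast)+
      then show "\<bar>norm (\<Sum>i<k. scl (a i) (x (r (n i)))) - norm (\<Sum>i<k. scl (a i) (x (r (n' i))))\<bar> < e"
        using m(2) by linarith
    qed
  qed
qed

text \<open>
  The terms of the spreading model are bounded sequences of scalars. The coordinate \<open>l\<close> belongs to the
  \<open>l\<close>-th list \<open>d\<close> in a countable dense family of coefficient lists. It is the limit, as the shift \<open>q\<close>
  tends to infinity, of the functional that norms \<open>\<Sum>i. d\<^sub>i y\<^bsub>q+i\<^esub>\<close>, evaluated at the shifted sequence.
  No coordinate exceeds the limit norm, and density of the lists shows that the supremum
  attains it.
\<close>
theorem spreading_model_exists:
  fixes x :: "nat \<Rightarrow> 'a"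
  assumes "\<And>n. norm (x n) \<le> B" and "0 < B"
  obtains r and s :: "nat \<Rightarrow> (nat \<Rightarrow>\<^sub>C 'k)"
  where "strict_mono r" "generates_spreading_model scl (x \<circ> r) linf_scale s"
proof -
  obtain r :: "nat \<Rightarrow> nat" where r: "strict_mono r"
    and stable: "\<forall>k :: nat. \<forall>e>0. \<exists>m. \<forall>n n' a.
      strict_mono_on {..<k} n \<and> strict_mono_on {..<k} n' \<and> (\<forall>i<k. m \<le> n i \<and> m \<le> n' i) \<and>
      (\<forall>i<k. norm (a i) \<le> 1) \<longrightarrow>
      \<bar>norm (\<Sum>i<k. scl (a i) (x (r (n i)))) - norm (\<Sum>i<k. scl (a i) (x (r (n' i))))\<bar> < e"
    using asymptotically_stable_subsequence[where x = x, OF assms]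
    by (elim exE conjE) (erule (1) that)
  define y where "y = x \<circ> r"
  have y: "norm (y n) \<le> B" for n by (simp add: y_def assms)
  obtain U where U: "free_ultrafilter U" using free_ultrafilter_exists by blast
  then have nt: "U \<noteq> bot" and Useq: "U \<le> sequentially" by (simp_all add: free_ultrafilter_def)
  obtain D :: "'k set" where D: "countable D" "\<And>X. open X \<Longrightarrow> X \<noteq> {} \<Longrightarrow> \<exists>d\<in>D. d \<in> X"
    using countable_dense_exists by metis
  have "D \<noteq> {}" using D(2)[of UNIV] by auto
  define ds where "ds = from_nat_into (lists D)"
  define w where "w l q = (\<Sum>i<length (ds l). scl (ds l ! i) (y (q + i)))" for l q
  define \<sigma> where "\<sigma> l i = Lim U (\<lambda>q. norming (w l q) (y (q + i)))" for l i
  have le_B: "norm (norming (w l q) (y (q + i))) \<le> B" for l q i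
    using dual_ballD(3)[OF norming(1)] y order_trans by blast
  have \<sigma>: "((\<lambda>q. norming (w l q) (y (q + i))) \<longlongrightarrow> \<sigma> l i) U" for l i
    unfolding \<sigma>_def using le_B by (intro free_ultrafilter_tendsto[OF U]) (auto simp: bounded_iff)
  have \<sigma>_le: "norm (\<sigma> l i) \<le> B" for l i
    by (rule tendsto_upperbound[OF tendsto_norm[OF \<sigma>] _ nt]) (simp add: le_B)
  define s where "s i = Bcontfun (\<lambda>l. \<sigma> l i)" for i
  have s: "apply_bcontfun (s i) l = \<sigma> l i" for i l
  proof -
    have "(\<lambda>l. \<sigma> l i) \<in> bcontfun"
      by (rule bcontfun_normI[where b = B]) (auto simp: \<sigma>_le)
    then show ?thesis by (simp add: s_def Bcontfun_inverse)
  qed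
  have coord: "((\<lambda>q. norm (norming (w l q) (\<Sum>i<k. scl (a i) (y (q + i)))))
      \<longlongrightarrow> norm (apply_bcontfun (\<Sum>i<k. linf_scale (a i) (s i)) l)) U" for l k a
  proof -
    have "apply_bcontfun (\<Sum>i<k. linf_scale (a i) (s i)) l = (\<Sum>i<k. a i * \<sigma> l i)"
      by (induction k) (simp_all add: s)
    moreover have "((\<lambda>q. \<Sum>i<k. a i * norming (w l q) (y (q + i))) \<longlongrightarrow> (\<Sum>i<k. a i * \<sigma> l i)) U"
      by (intro tendsto_sum tendsto_mult_left \<sigma>)
    ultimately show ?thesis
      by (simp add: dual_ball_sum[OF norming(1)] tendsto_norm)
  qed
  define L where "L k a = Lim U (\<lambda>q. norm (\<Sum>i<k. scl (a i) (y (q + i))))" for k a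
  have L: "((\<lambda>q. norm (\<Sum>i<k. scl (a i) (y (q + i)))) \<longlongrightarrow> L k a) U" for k a
  proof -
    have "norm (\<Sum>i<k. scl (a i) (y (q + i))) \<le> (\<Sum>i<k. norm (a i) * B)" for q
      using y by (intro sum_norm_le) (simp add: norm_scale mult_left_mono)
    then show ?thesis
      unfolding L_def by (intro free_ultrafilter_tendsto[OF U]) (auto simp: bounded_iff)
  qed
  have norm_s: "norm (\<Sum>i<k. linf_scale (a i) (s i)) = L k a" for k a
  proof (rule antisym)
    let ?v = "\<lambda>a q. \<Sum>i<k. scl (a i) (y (q + i))"
    show "norm (\<Sum>i<k. linf_scale (a i) (s i)) \<le> L k a"
    proof (rule norm_bound)
      show "norm (apply_bcontfun (\<Sum>i<k. linf_scale (a i) (s i)) l) \<le> L k a" for l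
        by (rule tendsto_le[OF nt L coord]) (simp add: dual_ballD(3)[OF norming(1)])
    qed
    show "L k a \<le> norm (\<Sum>i<k. linf_scale (a i) (s i))"
    proof (rule field_le_epsilon)
      fix e :: real assume "0 < e"
      define \<delta> where "\<delta> = e / (2 * (real k + 1) * B)"
      have "0 < \<delta>" using \<open>0 < e\<close> \<open>0 < B\<close> by (simp add: \<delta>_def)
      have "\<exists>d\<in>D. d \<in> ball (a i) \<delta>" for i
        using \<open>0 < \<delta>\<close> by (intro D(2)) auto
      then obtain d where d: "\<And>i. d i \<in> D" "\<And>i. norm (a i - d i) < \<delta>"
        unfolding mem_ball dist_norm by metis
      have "map d [0..<k] \<in> lists D" using d(1) by auto
      then obtain l where l: "ds l = map d [0..<k]"
        unfolding ds_def using from_nat_into_surj D(1) by (metis countable_lists)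
      have w: "w l q = ?v d q" for q unfolding w_def l by simp
      have "norm (?v a q) - e \<le> norm (norming (w l q) (?v a q))" for q
      proof -
        have "norm (?v a q - ?v d q) \<le> real (card {..<k}) * (\<delta> * B)"
          using d(2) y \<open>0 < B\<close> \<open>0 < \<delta>\<close> by (intro norm_sum_scl_diff_le) (auto intro: less_imp_le)
        also have "\<dots> \<le> (real k + 1) * (\<delta> * B)"
          using \<open>0 < B\<close> \<open>0 < \<delta>\<close> by (intro mult_right_mono) auto
        also have "\<dots> = e / 2"
        proof -
          have "K * (e / (2 * K * B) * B) = e / 2" if "0 < K" for K :: real
            using that \<open>0 < B\<close> by (simp add: field_simps)
          from this[of "real k + 1"] show ?thesis unfolding \<delta>_def by simp
        qed
        finally have diff: "norm (?v a q - ?v d q) \<le> e / 2" .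
        have split: "norming (w l q) (?v a q) = norming (w l q) (?v d q) + norming (w l q) (?v a q - ?v d q)"
          using dual_ballD(1)[OF norming(1), of "w l q" "?v d q" "?v a q - ?v d q"] by simp
        have "norm (norming (w l q) (?v d q)) = norm (?v d q)"
          using norming(2)[of "w l q"] by (simp add: w)
        moreover have "norm (norming (w l q) (?v a q - ?v d q)) \<le> e / 2"
          using dual_ballD(3)[OF norming(1)] diff order_trans by blast
        ultimately show ?thesis
          unfolding split
          using diff norm_triangle_sub[of "?v a q" "?v d q"]
            norm_diff_ineq[of "norming (w l q) (?v d q)" "norming (w l q) (?v a q - ?v d q)"]
          by linarith
      qed
      then have "L k a - e \<le> norm (apply_bcontfun (\<Sum>i<k. linf_scale (a i) (s i)) l)"
        by (intro tendsto_le[OF nt coord tendsto_diff[OF L tendsto_const]] always_eventually) simp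
      also have "\<dots> \<le> norm (\<Sum>i<k. linf_scale (a i) (s i))" by (rule norm_bounded)
      finally show "L k a \<le> norm (\<Sum>i<k. linf_scale (a i) (s i)) + e" by simp
    qed
  qed
  have "generates_spreading_model scl (x \<circ> r) linf_scale s"
    unfolding generates_spreading_model_def
  proof (intro allI impI)
    fix k :: nat and e :: real assume "0 < e"
    then obtain m where m: "\<forall>n n' a.
      strict_mono_on {..<k} n \<and> strict_mono_on {..<k} n' \<and> (\<forall>i<k. m \<le> n i \<and> m \<le> n' i) \<and>
      (\<forall>i<k. norm (a i) \<le> 1) \<longrightarrow>
      \<bar>norm (\<Sum>i<k. scl (a i) (x (r (n i)))) - norm (\<Sum>i<k. scl (a i) (x (r (n' i))))\<bar> < e / 2"
      using stable[rule_format, of "e / 2" k] by auto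
    show "\<exists>m. \<forall>n a. strict_mono_on {..<k} n \<and> (\<forall>i<k. m \<le> n i) \<and> (\<forall>i<k. norm (a i) \<le> 1) \<longrightarrow>
      \<bar>norm (\<Sum>i<k. linf_scale (a i) (s i)) - norm (\<Sum>i<k. scl (a i) ((x \<circ> r) (n i)))\<bar> < e"
    proof (intro exI[of _ m] allI impI, elim conjE)
      fix n and a :: "nat \<Rightarrow> 'k"
      assume n: "strict_mono_on {..<k} n" "\<forall>i<k. m \<le> n i" and a: "\<forall>i<k. norm (a i) \<le> 1"
      have "\<bar>norm (\<Sum>i<k. scl (a i) (y (q + i))) - norm (\<Sum>i<k. scl (a i) (y (n i)))\<bar> \<le> e / 2"
        if "m \<le> q" for q
      proof -
        have "strict_mono_on {..<k} (\<lambda>i. q + i)" by (auto intro: strict_mono_onI)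
        then show ?thesis
          using m[rule_format, of "\<lambda>i. q + i" n a] n a that by (simp add: y_def)
      qed
      then have "\<forall>\<^sub>F q in sequentially.
          \<bar>norm (\<Sum>i<k. scl (a i) (y (q + i))) - norm (\<Sum>i<k. scl (a i) (y (n i)))\<bar> \<le> e / 2"
        unfolding eventually_sequentially by blast
      then have "\<bar>L k a - norm (\<Sum>i<k. scl (a i) (y (n i)))\<bar> \<le> e / 2"
        by (intro tendsto_upperbound[OF tendsto_rabs[OF tendsto_diff[OF L tendsto_const]] _ nt]
              filter_leD[OF Useq])
      then show "\<bar>norm (\<Sum>i<k. linf_scale (a i) (s i)) - norm (\<Sum>i<k. scl (a i) ((x \<circ> r) (n i)))\<bar> < e"
        using \<open>0 < e\<close> by (simp add: norm_s y_def)
    qed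
  qed
  with r show thesis by (rule that)
qed

end

section \<open>Large far out sums in the absence of a \<open>c\<^sub>0\<close> spreading model\<close>
text \<open>
  A convex function on the cube is largest at a vertex.
\<close>
lemma norm_convex_multiplier_le:
  fixes v :: "'i \<Rightarrow> 'v::real_normed_vector"
  assumes "finite G" "\<forall>i\<in>G. 0 \<le> t i \<and> t i \<le> (1::real)"
  shows "\<exists>F\<subseteq>G. norm (w + (\<Sum>i\<in>G. t i *\<^sub>R v i)) \<le> norm (w + (\<Sum>i\<in>F. v i))"
  using assms
proof (induction G arbitrary: w rule: finite_induct)
  case (insert g G)
  then obtain F where F: "F \<subseteq> G"
    "norm ((w + t g *\<^sub>R v g) + (\<Sum>i\<in>G. t i *\<^sub>R v i)) \<le> norm ((w + t g *\<^sub>R v g) + (\<Sum>i\<in>F. v i))"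
    by blast
  let ?u = "w + (\<Sum>i\<in>F. v i)"
  have "finite F" "g \<notin> F" using F(1) insert.hyps finite_subset by auto
  have "(w + t g *\<^sub>R v g) + (\<Sum>i\<in>F. v i) = (1 - t g) *\<^sub>R ?u + t g *\<^sub>R (?u + v g)"
    by (simp add: algebra_simps)
  also have "norm \<dots> \<le> (1 - t g) * norm ?u + t g * norm (?u + v g)"
    using norm_triangle_ineq[of "(1 - t g) *\<^sub>R ?u" "t g *\<^sub>R (?u + v g)"] insert.prems by simp
  also have "\<dots> \<le> max (norm ?u) (norm (?u + v g))"
    using insert.prems by (intro convex_bound_le) auto
  finally have le: "norm (w + (\<Sum>i\<in>insert g G. t i *\<^sub>R v i)) \<le> max (norm ?u) (norm (?u + v g))"
    using F(2) insert.hyps by (simp add: add.assoc)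
  show ?case
  proof (cases "norm ?u \<le> norm (?u + v g)")
    case True
    then have "norm (w + (\<Sum>i\<in>insert g G. t i *\<^sub>R v i)) \<le> norm (w + (\<Sum>i\<in>insert g F. v i))"
      using le \<open>finite F\<close> \<open>g \<notin> F\<close> by (simp add: algebra_simps)
    then show ?thesis using F(1) by (intro exI[of _ "insert g F"]) auto
  next
    case False
    then show ?thesis using le F(1) by (intro exI[of _ F]) auto
  qed
qed auto

context banach_space_over
begin

text \<open>
  Suppression of coordinates controls multipliers in \<open>[0, 1]\<close> by convexity, real multipliers of
  modulus at most \<open>1\<close> by splitting into positive and negative part, and scalar multipliers by
  expansion in a real basis of the field.
\<close>
lemma multiplier_bound:
  assumes G: "finite G"
    and K: "\<And>F. F \<subseteq> G \<Longrightarrow> norm (\<Sum>i\<in>F. scl (a i) (v i)) \<le> K"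
    and t: "\<And>i. i \<in> G \<Longrightarrow> norm (t i) \<le> 1"
  shows "norm (\<Sum>i\<in>G. scl (t i * a i) (v i)) \<le> 2 * real DIM('k) * K"
proof -
  let ?v = "\<lambda>i. scl (a i) (v i)"
  have unit: "norm (\<Sum>i\<in>G. \<rho> i *\<^sub>R ?v i) \<le> K" if \<rho>: "\<forall>i\<in>G. 0 \<le> \<rho> i \<and> \<rho> i \<le> (1::real)" for \<rho>
  proof -
    obtain F where "F \<subseteq> G" "norm (\<Sum>i\<in>G. \<rho> i *\<^sub>R ?v i) \<le> norm (\<Sum>i\<in>F. ?v i)"
      using norm_convex_multiplier_le[OF G \<rho>, of 0 ?v] by (auto simp only: add_0)
    with K[of F] show ?thesis by simp
  qed
  have signed: "norm (\<Sum>i\<in>G. \<rho> i *\<^sub>R ?v i) \<le> 2 * K" if "\<forall>i\<in>G. \<bar>\<rho> i\<bar> \<le> (1::real)" for \<rho>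
  proof -
    have "\<rho> i *\<^sub>R ?v i = max (\<rho> i) 0 *\<^sub>R ?v i - max (- \<rho> i) 0 *\<^sub>R ?v i" for i
      by (simp add: max_def flip: scaleR_diff_left)
    then have "(\<Sum>i\<in>G. \<rho> i *\<^sub>R ?v i)
        = (\<Sum>i\<in>G. max (\<rho> i) 0 *\<^sub>R ?v i) - (\<Sum>i\<in>G. max (- \<rho> i) 0 *\<^sub>R ?v i)"
      by (simp flip: sum_subtractf)
    also have "norm \<dots> \<le> K + K"
      using that by (intro order_trans[OF norm_triangle_ineq4] add_mono unit) (auto simp: abs_le_iff)
    finally show ?thesis by simp
  qed
  have "scl (t i * a i) (v i) = (\<Sum>b\<in>Basis. scl b ((t i \<bullet> b) *\<^sub>R ?v i))" for i
  proof -
    have "scl (t i * a i) (v i) = scl (\<Sum>b\<in>Basis. (t i \<bullet> b) *\<^sub>R b) (?v i)"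
      by (simp add: euclidean_representation)
    also have "\<dots> = (\<Sum>b\<in>Basis. (t i \<bullet> b) *\<^sub>R scl b (?v i))"
      by (simp only: scale_sum_left scl_scaleR)
    also have "\<dots> = (\<Sum>b\<in>Basis. scl b ((t i \<bullet> b) *\<^sub>R ?v i))"
      by (simp add: mult_ac flip: scale_of_real)
    finally show ?thesis .
  qed
  then have "(\<Sum>i\<in>G. scl (t i * a i) (v i)) = (\<Sum>b\<in>Basis. scl b (\<Sum>i\<in>G. (t i \<bullet> b) *\<^sub>R ?v i))"
    by (simp add: scale_sum_right sum.swap[of _ Basis])
  also have "norm \<dots> \<le> real DIM('k) * (2 * K)"
  proof (rule sum_norm_bound)
    fix b :: 'k assume b: "b \<in> Basis"
    have "\<forall>i\<in>G. \<bar>t i \<bullet> b\<bar> \<le> 1" using t Basis_le_norm[OF b] order_trans by blast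
    then show "norm (scl b (\<Sum>i\<in>G. (t i \<bullet> b) *\<^sub>R ?v i)) \<le> 2 * K"
      using signed[of "\<lambda>i. t i \<bullet> b"] b by (simp add: norm_scale)
  qed
  finally show ?thesis by simp
qed

text \<open>
  Suppression to singletons gives the lower \<open>c\<^sub>0\<close> estimate. For the upper one, a
  combination with coefficients of modulus at most \<open>m\<close> arises from a partial sum of the basis by
  suppression, multiplication by \<open>m\<close> and multipliers of modulus at most \<open>1\<close>.
\<close>
lemma equivalent_c0_basis_if_bounded_sums:
  fixes s :: "nat \<Rightarrow> 'a"
  assumes supp: "\<And>a F G. finite G \<Longrightarrow> F \<subseteq> G \<Longrightarrow>
      norm (\<Sum>i\<in>F. scl (a i) (s i)) \<le> C * norm (\<Sum>i\<in>G. scl (a i) (s i))"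
    and "0 < C" "0 < b" and b: "\<And>i. b \<le> norm (s i)"
    and \<Lambda>: "\<And>n. norm (\<Sum>i<n. s i) \<le> \<Lambda>"
  shows "equivalent_c0_basis scl s"
proof -
  let ?D = "2 * real DIM('k) * (C * \<Lambda>)"
  have "0 \<le> \<Lambda>" using \<Lambda>[of 0] by simp
  have "0 < b / C" using \<open>0 < b\<close> \<open>0 < C\<close> by simp
  moreover have "b / C * (SUP i. norm (a i)) \<le> norm (\<Sum>i | a i \<noteq> 0. scl (a i) (s i)) \<and>
      norm (\<Sum>i | a i \<noteq> 0. scl (a i) (s i)) \<le> max (b / C) ?D * (SUP i. norm (a i))"
    if fin: "finite {i. a i \<noteq> 0}" for a :: "nat \<Rightarrow> 'k"
  proof
    let ?G = "{i. a i \<noteq> 0}" and ?m = "SUP i. norm (a i)"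
    let ?N = "norm (\<Sum>i\<in>?G. scl (a i) (s i))"
    have "range (\<lambda>i. norm (a i)) \<subseteq> insert 0 ((\<lambda>i. norm (a i)) ` ?G)" by auto
    then have "finite (range (\<lambda>i. norm (a i)))" using fin finite_subset by blast
    then have m: "norm (a i) \<le> ?m" for i by (intro cSUP_upper bdd_above_finite) auto
    then have "0 \<le> ?m" using norm_ge_zero order_trans by blast
    have "?m \<le> C / b * ?N"
    proof (rule cSUP_least)
      fix i
      show "norm (a i) \<le> C / b * ?N"
      proof (cases "i \<in> ?G")
        case True
        have "norm (a i) * b \<le> norm (a i) * norm (s i)" by (intro mult_left_mono b) simp
        also have "\<dots> = norm (\<Sum>i\<in>{i}. scl (a i) (s i))" by (simp add: norm_scale)
        also have "\<dots> \<le> C * ?N" using True by (intro supp fin) auto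
        finally show ?thesis using \<open>0 < b\<close> by (simp add: field_simps)
      qed (use \<open>0 < b\<close> \<open>0 < C\<close> in simp)
    qed simp
    then show "b / C * ?m \<le> ?N" using \<open>0 < b\<close> \<open>0 < C\<close> by (simp add: field_simps)
    have "?N \<le> ?D * ?m"
    proof (cases "?m = 0")
      case True
      then have "?G = {}" using m by force
      then show ?thesis using True by simp
    next
      case False
      with \<open>0 \<le> ?m\<close> have "0 < ?m" by simp
      have "norm (\<Sum>i\<in>?G. scl (a i / of_real ?m * of_real ?m) (s i)) \<le> 2 * real DIM('k) * (?m * (C * \<Lambda>))"
      proof (rule multiplier_bound[OF fin])
        show "norm (a i / of_real ?m) \<le> 1" for i
          using m[of i] \<open>0 < ?m\<close> by (simp add: norm_divide)
        fix F assume "F \<subseteq> ?G"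
        then have "finite F" using fin by (rule finite_subset)
        then obtain n where n: "F \<subseteq> {..<n}" by (auto simp: finite_nat_iff_bounded)
        have "norm (\<Sum>i\<in>F. s i) \<le> C * norm (\<Sum>i<n. s i)"
          using supp[of "{..<n}" F "\<lambda>_. 1"] n by simp
        also have "\<dots> \<le> C * \<Lambda>" using \<open>0 < C\<close> by (intro mult_left_mono \<Lambda>) simp
        finally have "norm (scl (of_real ?m) (\<Sum>i\<in>F. s i)) \<le> ?m * (C * \<Lambda>)"
          using \<open>0 < ?m\<close> by (simp only: norm_scale norm_of_real) (simp add: mult_left_mono)
        then show "norm (\<Sum>i\<in>F. scl (of_real ?m) (s i)) \<le> ?m * (C * \<Lambda>)"
          by (simp only: scale_sum_right)
      qed
      then show ?thesis using \<open>0 < ?m\<close> by (simp add: mult_ac)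
    qed
    also have "?D * ?m \<le> max (b / C) ?D * ?m" using \<open>0 \<le> ?m\<close> by (intro mult_right_mono) auto
    finally show "?N \<le> max (b / C) ?D * ?m" .
  qed
  ultimately show ?thesis
    unfolding equivalent_c0_basis_def by (intro exI[of _ "b / C"] exI[of _ "max (b / C) ?D"]) auto
qed

text \<open>
  The definition of a spreading model restricts the coefficients to the unit ball; scaling removes
  this restriction.
\<close>
lemma spreading_model_tendsto:
  assumes gen: "generates_spreading_model scl w linf_scale s" and "finite G"
  shows "(\<lambda>q. norm (\<Sum>i\<in>G. scl (a i) (w (q + i)))) \<longlonglongrightarrow> norm (\<Sum>i\<in>G. linf_scale (a i) (s i))"
proof -
  interpret L: banach_space_over "linf_scale :: 'k \<Rightarrow> (nat \<Rightarrow>\<^sub>C 'k) \<Rightarrow> _"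
    by (rule banach_space_over_linf_scale)
  obtain k where k: "G \<subseteq> {..<k}" using \<open>finite G\<close> finite_nat_iff_bounded by auto
  define m where "m = 1 + (\<Sum>i\<in>G. norm (a i))"
  have "0 \<le> (\<Sum>i\<in>G. norm (a i))" by (intro sum_nonneg) auto
  then have "0 < m" by (simp add: m_def)
  define c where "c i = (if i \<in> G then a i / of_real m else 0)" for i
  have c_le: "norm (c i) \<le> 1" for i
  proof -
    have "norm (a i) \<le> m" if "i \<in> G"
      using member_le_sum[of i G "\<lambda>i. norm (a i)"] that \<open>finite G\<close> by (simp add: m_def)
    then show ?thesis using \<open>0 < m\<close> by (simp add: c_def norm_divide)
  qed
  have c_sum: "(\<Sum>i\<in>G. scl (a i) (v i)) = scl (of_real m) (\<Sum>i<k. scl (c i) (v i))" for v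
  proof -
    have "(\<Sum>i<k. scl (c i) (v i)) = (\<Sum>i\<in>G. scl (a i / of_real m) (v i))"
      using k by (intro sum.mono_neutral_cong_right) (auto simp: c_def)
    then show ?thesis using \<open>0 < m\<close> by (simp add: scale_sum_right)
  qed
  have cL_sum: "(\<Sum>i\<in>G. linf_scale (a i) (v i)) = linf_scale (of_real m) (\<Sum>i<k. linf_scale (c i) (v i))" for v
  proof -
    have "(\<Sum>i<k. linf_scale (c i) (v i)) = (\<Sum>i\<in>G. linf_scale (a i / of_real m) (v i))"
      using k by (intro sum.mono_neutral_cong_right) (auto simp: c_def)
    then show ?thesis using \<open>0 < m\<close> by (simp add: L.scale_sum_right)
  qed
  have "(\<lambda>q. norm (\<Sum>i<k. scl (c i) (w (q + i)))) \<longlonglongrightarrow> norm (\<Sum>i<k. linf_scale (c i) (s i))"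
  proof (rule LIMSEQ_I)
    fix e :: real assume "0 < e"
    then obtain N where N: "\<And>n a. strict_mono_on {..<k} n \<and> (\<forall>i<k. N \<le> n i) \<and> (\<forall>i<k. norm (a i) \<le> 1) \<Longrightarrow>
      \<bar>norm (\<Sum>i<k. linf_scale (a i) (s i)) - norm (\<Sum>i<k. scl (a i) (w (n i)))\<bar> < e"
      using gen unfolding generates_spreading_model_def by meson
    have "norm (norm (\<Sum>i<k. scl (c i) (w (q + i))) - norm (\<Sum>i<k. linf_scale (c i) (s i))) < e"
      if "N \<le> q" for q
      using N[of "\<lambda>i. q + i" c] that c_le by (simp add: strict_mono_on_def abs_minus_commute)
    then show "\<exists>N. \<forall>q\<ge>N. norm (norm (\<Sum>i<k. scl (c i) (w (q + i)))
        - norm (\<Sum>i<k. linf_scale (c i) (s i))) < e" by blast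
  qed
  then show ?thesis
    unfolding c_sum cL_sum norm_scale L.norm_scale by (intro tendsto_intros)
qed

text \<open>
  After passing to a subsequence, sets that are small compared with their distance from the origin
  can be suppressed with constant \<open>2\<close>, so its spreading model \<open>s\<close> is suppression unconditional. If
  the sums \<open>s\<^sub>0 + \<dots> + s\<^bsub>k-1\<^esub>\<close> were bounded, \<open>s\<close> would be equivalent to the basis of \<open>c\<^sub>0\<close>. So
  they are unbounded, and they approximate the sums over far out sets of \<open>k\<close> terms. Multipliers turn
  those into sums with arbitrary coefficients of modulus at least \<open>\<delta>\<close>.
\<close>
theorem far_sums_large:
  assumes wn: "weakly_null scl x" and sn: "seminormalized x"
    and no_c0: "\<forall>r :: nat \<Rightarrow> nat. strict_mono r \<longrightarrow> \<not> has_c0_spreading_model scl (x \<circ> r)"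
  shows "\<exists>r :: nat \<Rightarrow> nat. strict_mono r \<and> (\<forall>\<delta>>0. \<forall>H. \<exists>k m. \<forall>F a.
    finite F \<and> F \<subseteq> {m..} \<and> card F = k \<and> (\<forall>i\<in>F. \<delta> \<le> norm (a i)) \<longrightarrow>
    H \<le> norm (\<Sum>i\<in>F. scl (a i) (x (r i))))"
proof -
  obtain r1 where r1: "strict_mono r1"
    and S: "\<forall>G F j a. finite G \<longrightarrow> F \<subseteq> G \<inter> {j..} \<longrightarrow> card F \<le> j \<longrightarrow>
      norm (\<Sum>i\<in>(G \<inter> {..<j}) \<union> F. scl (a i) (x (r1 i)))
        \<le> (1 + 1) * norm (\<Sum>i\<in>G. scl (a i) (x (r1 i)))"
    using schreier_suppression[where M = "\<lambda>j. j", OF wn sn zero_less_one] by blast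
  obtain b B where b: "0 < b" "\<And>n. b \<le> norm (x n)" and B: "0 < B" "\<And>n. norm (x n) \<le> B"
    using seminormalizedE[OF sn] by metis
  obtain r2 and s :: "nat \<Rightarrow> (nat \<Rightarrow>\<^sub>C 'k)" where r2: "strict_mono r2"
    and gen: "generates_spreading_model scl ((x \<circ> r1) \<circ> r2) linf_scale s"
    using spreading_model_exists[of "x \<circ> r1" B] B by (metis comp_apply)
  define w where "w = (x \<circ> r1) \<circ> r2"
  interpret L: banach_space_over "linf_scale :: 'k \<Rightarrow> (nat \<Rightarrow>\<^sub>C 'k) \<Rightarrow> _"
    by (rule banach_space_over_linf_scale)
  have lim: "(\<lambda>q. norm (\<Sum>i\<in>G. scl (a i) (w (q + i)))) \<longlonglongrightarrow> norm (\<Sum>i\<in>G. linf_scale (a i) (s i))"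
    if "finite G" for G a
    using spreading_model_tendsto[OF gen that] by (simp add: w_def)
  have supp: "norm (\<Sum>i\<in>F. scl (a i) (w i)) \<le> 2 * norm (\<Sum>i\<in>G. scl (a i) (w i))"
    if "finite G" "F \<subseteq> G" "G \<subseteq> {j..}" "card F \<le> j" for F G j a
  proof -
    have inj: "inj_on r2 A" for A 
      by (rule inj_on_subset[OF strict_mono_imp_inj_on[OF r2] subset_UNIV])
    let ?a = "\<lambda>i. a (inv r2 i)"
    have "j \<le> r2 i" if "i \<in> G" for i
      using seq_suble[OF r2, of i] \<open>G \<subseteq> {j..}\<close> that by fastforce
    then have "r2 ` G \<inter> {..<j} = {}" "r2 ` F \<subseteq> r2 ` G \<inter> {j..}"
      using \<open>F \<subseteq> G\<close> by fastforce+
    moreover have "card (r2 ` F) \<le> j" using \<open>card F \<le> j\<close> by (simp add: card_image inj)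
    ultimately have "norm (\<Sum>i\<in>r2 ` F. scl (?a i) (x (r1 i))) \<le> 2 * norm (\<Sum>i\<in>r2 ` G. scl (?a i) (x (r1 i)))"
      using S[rule_format, of "r2 ` G" "r2 ` F" j ?a] \<open>finite G\<close> by simp
    then show ?thesis
      by (simp add: sum.reindex inj w_def)
  qed
  have shift: "(\<Sum>i\<in>(+) q ` A. scl (a (i - q)) (w i)) = (\<Sum>i\<in>A. scl (a i) (w (q + i)))" for q A a
    by (simp add: sum.reindex)
  have supp_s: "norm (\<Sum>i\<in>F. linf_scale (a i) (s i)) \<le> 2 * norm (\<Sum>i\<in>G. linf_scale (a i) (s i))"
    if "finite G" "F \<subseteq> G" for F G a
  proof (rule LIMSEQ_le)
    show "(\<lambda>q. norm (\<Sum>i\<in>F. scl (a i) (w (q + i)))) \<longlonglongrightarrow> norm (\<Sum>i\<in>F. linf_scale (a i) (s i))"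
      using that finite_subset by (intro lim) blast
    show "(\<lambda>q. 2 * norm (\<Sum>i\<in>G. scl (a i) (w (q + i)))) \<longlonglongrightarrow> 2 * norm (\<Sum>i\<in>G. linf_scale (a i) (s i))"
      by (intro tendsto_mult_left lim that)
    have "norm (\<Sum>i\<in>F. scl (a i) (w (q + i))) \<le> 2 * norm (\<Sum>i\<in>G. scl (a i) (w (q + i)))"
      if "card F \<le> q" for q
    proof -
      have "(+) q ` F \<subseteq> (+) q ` G" "(+) q ` G \<subseteq> {q..}" "card ((+) q ` F) \<le> q"
        using \<open>F \<subseteq> G\<close> that by (auto simp: card_image)
      from supp[OF _ this, of "\<lambda>i. a (i - q)"] \<open>finite G\<close> show ?thesis by (simp only: shift finite_imageI)
    qed
    then show "\<exists>N. \<forall>q\<ge>N. norm (\<Sum>i\<in>F. scl (a i) (w (q + i))) \<le> 2 * norm (\<Sum>i\<in>G. scl (a i) (w (q + i)))"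
      by blast
  qed
  have b_s: "b \<le> norm (s i)" for i
  proof (rule LIMSEQ_le_const)
    show "(\<lambda>q. norm (w (q + i))) \<longlonglongrightarrow> norm (s i)"
      using lim[of "{i}" "\<lambda>_. 1"] by simp
  qed (use b(2) in \<open>auto simp: w_def\<close>)
  have unbounded: "\<exists>k. \<Lambda> < norm (\<Sum>i<k. s i)" for \<Lambda>
  proof (rule ccontr)
    assume "\<not> ?thesis"
    then have "equivalent_c0_basis linf_scale s"
      using b(1) b_s
      by (intro L.equivalent_c0_basis_if_bounded_sums[where C = 2 and b = b and \<Lambda> = \<Lambda>] supp_s)
         (auto simp: not_less)
    with gen have "has_c0_spreading_model scl (x \<circ> (r1 \<circ> r2))"
      unfolding has_c0_spreading_model_def by (auto simp: comp_assoc)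
    then show False using no_c0 r1 r2 by (simp add: strict_mono_o)
  qed
  have "\<exists>k m. \<forall>F a. finite F \<and> F \<subseteq> {m..} \<and> card F = k \<and> (\<forall>i\<in>F. \<delta> \<le> norm (a i)) \<longrightarrow>
      H \<le> norm (\<Sum>i\<in>F. scl (a i) (w i))" if "0 < \<delta>" for \<delta> H
  proof -
    let ?K = "2 * real DIM('k) * 2"
    have "0 < ?K" by simp
    \<comment> \<open>The summand \<open>1\<close> pays for replacing \<open>s\<close> by far out terms of \<open>w\<close>.\<close>
    obtain k where k: "?K * H / \<delta> + 1 < norm (\<Sum>i<k. s i)" using unbounded by blast
    obtain m where m: "\<And>n a. strict_mono_on {..<k} n \<and> (\<forall>i<k. m \<le> n i) \<and> (\<forall>i<k. norm (a i) \<le> 1) \<Longrightarrow>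
      \<bar>norm (\<Sum>i<k. linf_scale (a i) (s i)) - norm (\<Sum>i<k. scl (a i) (w (n i)))\<bar> < 1"
      using gen unfolding generates_spreading_model_def w_def by (meson zero_less_one)
    have "H \<le> norm (\<Sum>i\<in>F. scl (a i) (w i))"
      if F: "finite F" "F \<subseteq> {max m k..}" "card F = k" and a: "\<forall>i\<in>F. \<delta> \<le> norm (a i)" for F a
    proof -
      let ?N = "norm (\<Sum>i\<in>F. scl (a i) (w i))"
      let ?n = "\<lambda>i. sorted_list_of_set F ! i"
      have len: "length (sorted_list_of_set F) = k" using F(3) by simp
      have sm: "strict_mono_on {..<k} ?n"
        using F(1) len strict_sorted_list_of_set[of F]
        by (auto simp: strict_mono_on_def sorted_wrt_iff_nth_less)
      have "?n i \<in> F" if "i < k" for i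
        using that len F(1) by (metis nth_mem set_sorted_list_of_set)
      then have "\<forall>i<k. m \<le> ?n i" using F(2) by fastforce
      then have "\<bar>norm (\<Sum>i<k. s i) - norm (\<Sum>i<k. w (?n i))\<bar> < 1"
        using m[of ?n "\<lambda>_. 1"] sm by simp
      moreover have "(\<Sum>i<k. w (?n i)) = (\<Sum>i\<in>F. w i)"
      proof -
        have "bij_betw ?n {..<k} F"
          using bij_betw_nth[of "sorted_list_of_set F" "{..<k}" F] len F(1) by simp
        then show ?thesis by (rule sum.reindex_bij_betw)
      qed
      ultimately have "?K * H / \<delta> < norm (\<Sum>i\<in>F. w i)" using k by simp
      then have "?K * H < \<delta> * norm (\<Sum>i\<in>F. w i)" using \<open>0 < \<delta>\<close> by (simp add: field_simps)
      also have "\<delta> * norm (\<Sum>i\<in>F. w i) = norm (scl (of_real \<delta>) (\<Sum>i\<in>F. w i))"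
        using \<open>0 < \<delta>\<close> by (simp add: norm_scale)
      also have "scl (of_real \<delta>) (\<Sum>i\<in>F. w i) = (\<Sum>i\<in>F. scl (of_real \<delta> / a i * a i) (w i))"
        unfolding scale_sum_right using a \<open>0 < \<delta>\<close> by (intro sum.cong) auto
      also have "norm \<dots> \<le> 2 * real DIM('k) * (2 * ?N)"
      proof (rule multiplier_bound[OF F(1)])
        show "norm (of_real \<delta> / a i) \<le> 1" if "i \<in> F" for i
        proof -
          have "0 < norm (a i)" using a that \<open>0 < \<delta>\<close> less_le_trans by blast
          then show ?thesis using a that \<open>0 < \<delta>\<close> by (simp add: norm_divide)
        qed
        show "norm (\<Sum>i\<in>F'. scl (a i) (w i)) \<le> 2 * ?N" if "F' \<subseteq> F" for F'
        proof -
          have "F \<subseteq> {k..}" "card F' \<le> k" using F card_mono[OF F(1) that] by auto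
          with F(1) that show ?thesis by (rule supp)
        qed
      qed
      finally have "?K * H < ?K * ?N" by (simp add: mult.assoc)
      then show ?thesis using \<open>0 < ?K\<close> by (simp only: mult_less_cancel_left_pos less_imp_le)
    qed
    then show ?thesis by blast
  qed
  then show ?thesis
    using r1 r2 by (intro exI[of _ "r1 \<circ> r2"]) (auto simp: w_def strict_mono_o)
qed


section \<open>Schauder bases from bounded projections\<close>
lemma coefficient_bound:
  fixes y :: "nat \<Rightarrow> 'a"
  assumes proj: "\<And>G j a. finite G \<Longrightarrow>
      norm (\<Sum>i\<in>G \<inter> {..<j}. scl (a i) (y i)) \<le> K * norm (\<Sum>i\<in>G. scl (a i) (y i))"
    and b: "\<And>n. b \<le> norm (y n)" and G: "finite G" "i \<in> G"
  shows "norm (a i) * b \<le> 2 * K * norm (\<Sum>i\<in>G. scl (a i) (y i))"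
proof -
  let ?S = "\<lambda>A. \<Sum>i\<in>A. scl (a i) (y i)"
  have "G \<inter> {..<Suc i} = insert i (G \<inter> {..<i})" using G(2) by auto
  then have "scl (a i) (y i) = ?S (G \<inter> {..<Suc i}) - ?S (G \<inter> {..<i})"
    using G(1) by simp
  then have "norm (scl (a i) (y i)) \<le> norm (?S (G \<inter> {..<Suc i})) + norm (?S (G \<inter> {..<i}))"
    using norm_triangle_ineq4 by metis
  also have "\<dots> \<le> K * norm (?S G) + K * norm (?S G)" by (intro add_mono proj G(1))
  finally have "norm (a i) * norm (y i) \<le> 2 * K * norm (?S G)" by (simp add: norm_scale)
  moreover have "norm (a i) * b \<le> norm (a i) * norm (y i)" by (intro mult_left_mono b) simp
  ultimately show ?thesis by linarith
qed

text \<open>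
  Describing a finite combination by its eventually constant partial sums avoids supports and works
  although \<open>y\<close> is not known to be injective.
\<close>
lemma span_range_eventually_partial_sum:
  assumes "v \<in> span (range y)"
  shows "\<exists>c. \<forall>\<^sub>F n in sequentially. v = (\<Sum>i<n. scl (c i) (y i))"
proof -
  let ?S = "{v. \<exists>c. \<forall>\<^sub>F n in sequentially. v = (\<Sum>i<n. scl (c i) (y i))}"
  have "subspace ?S"
  proof (rule subspaceI)
    show "0 \<in> ?S" by (auto intro!: exI[of _ "\<lambda>_. 0"])
    show "u + v \<in> ?S" if uv: "u \<in> ?S" "v \<in> ?S" for u v
    proof -
      obtain c d where c: "\<forall>\<^sub>F n in sequentially. u = (\<Sum>i<n. scl (c i) (y i))"
        and d: "\<forall>\<^sub>F n in sequentially. v = (\<Sum>i<n. scl (d i) (y i))"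
        using uv by auto
      from c d have "\<forall>\<^sub>F n in sequentially. u + v = (\<Sum>i<n. scl (c i + d i) (y i))"
        by eventually_elim (simp add: scale_left_distrib sum.distrib)
      then show ?thesis by auto
    qed
    show "scl k v \<in> ?S" if v: "v \<in> ?S" for k v
    proof -
      obtain c where c: "\<forall>\<^sub>F n in sequentially. v = (\<Sum>i<n. scl (c i) (y i))" using v by auto
      then have "\<forall>\<^sub>F n in sequentially. scl k v = (\<Sum>i<n. scl (k * c i) (y i))"
        by eventually_elim (simp add: scale_sum_right)
      then show ?thesis by auto
    qed
  qed
  moreover have "range y \<subseteq> ?S"
  proof safe
    fix j
    have "\<forall>\<^sub>F n in sequentially. y j = (\<Sum>i<n. scl (if i = j then 1 else 0) (y i))"
      using eventually_gt_at_top[of j]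
    proof eventually_elim
      case (elim n)
      have "(\<Sum>i<n. scl (if i = j then 1 else 0) (y i)) = (\<Sum>i<n. if i = j then y i else 0)"
        by (intro sum.cong) auto
      then show ?case using elim by simp
    qed
    then show "\<exists>c. \<forall>\<^sub>F n in sequentially. y j = (\<Sum>i<n. scl (c i) (y i))"
      by (rule exI[where x = "\<lambda>i. if i = j then 1 else 0"])
  qed
  ultimately have "span (range y) \<subseteq> ?S" by (intro span_minimal)
  with assms show ?thesis by auto
qed

text \<open>
  The classical criterion. Approximate \<open>v\<close> by finite combinations \<open>u m\<close>. Coefficients are bounded
  linear functionals on finite combinations, so those of \<open>u m\<close> converge, and the uniform
  bound on the projections lets the partial sums of the limit expansion inherit convergence.
\<close>
theorem schauder_basis_if_bounded_projections:
  assumes proj: "\<And>G j a. finite G \<Longrightarrow>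
      norm (\<Sum>i\<in>G \<inter> {..<j}. scl (a i) (y i)) \<le> K * norm (\<Sum>i\<in>G. scl (a i) (y i))"
    and "0 < b" and b: "\<And>n. b \<le> norm (y n)"
  shows "schauder_basis scl y (closed_linear_span scl (range y))"
proof -
  let ?P = "\<lambda>c n. \<Sum>i<n. scl (c i) (y i)"
  have "1 \<le> K"
  proof -
    have "norm (y 0) \<le> K * norm (y 0)" using proj[of "{0}" "\<lambda>_. 1" 1] by simp
    moreover have "0 < norm (y 0)" using b[of 0] \<open>0 < b\<close> by linarith
    ultimately show ?thesis by simp
  qed
  have P_le: "norm (?P c n) \<le> K * norm (?P c N)" if "n \<le> N" for c n N
  proof -
    have "{..<N} \<inter> {..<n} = {..<n}" using that by auto
    then show ?thesis using proj[of "{..<N}" c n] by simp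
  qed
  have coef_le: "norm (c i) \<le> 2 * K / b * norm (?P c N)" if "i < N" for c i N
    using coefficient_bound[where K = K, OF proj b, of "{..<N}" i c] that \<open>0 < b\<close>
    by (simp add: field_simps)
  have P_diff: "?P (\<lambda>i. c i - d i) n = ?P c n - ?P d n" for c d n
    by (simp add: scale_left_diff_distrib sum_subtractf)
  have unique: "c = d" if "(\<lambda>i. scl (c i) (y i)) sums v" "(\<lambda>i. scl (d i) (y i)) sums v" for c d v
  proof
    fix i
    have "(\<lambda>n. ?P (\<lambda>i. c i - d i) n) \<longlonglongrightarrow> v - v"
      unfolding P_diff using that by (intro tendsto_diff) (simp_all add: sums_def)
    then have "(\<lambda>n. 2 * K / b * norm (?P (\<lambda>i. c i - d i) n)) \<longlonglongrightarrow> 2 * K / b * norm (v - v)"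
      by (intro tendsto_mult_left tendsto_norm)
    then have "norm (c i - d i) \<le> 2 * K / b * norm (v - v)"
      by (rule LIMSEQ_le_const) (use coef_le[of i _ "\<lambda>i. c i - d i"] in \<open>auto intro!: exI[of _ "Suc i"]\<close>)
    then show "c i = d i" by simp
  qed
  have expansion: "\<exists>c. (\<lambda>i. scl (c i) (y i)) sums v" if v: "v \<in> closed_linear_span scl (range y)" for v
  proof -
    obtain u where u: "\<And>m. u m \<in> span (range y)" "u \<longlonglongrightarrow> v"
      using v unfolding closed_linear_span_def closure_sequential by blast
    have "\<forall>m. \<exists>c. \<forall>\<^sub>F n in sequentially. u m = ?P c n"
      using span_range_eventually_partial_sum u(1) by blast
    then obtain c where c: "\<And>m. \<forall>\<^sub>F n in sequentially. u m = ?P (c m) n" by metis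
    have "\<exists>N. \<forall>n\<ge>N. u m = ?P (c m) n" for m using c[of m] by (simp add: eventually_sequentially)
    then obtain N where N: "\<And>m n. N m \<le> n \<Longrightarrow> ?P (c m) n = u m" by metis
    have diff: "?P (\<lambda>i. c m i - c l i) n = u m - u l" if "max (N m) (N l) \<le> n" for m l n
      using that N unfolding P_diff by simp
    have "Cauchy u" using u(2) LIMSEQ_imp_Cauchy by blast
    have "Cauchy (\<lambda>m. c m i)" for i
    proof (rule CauchyI)
      fix e :: real assume "0 < e"
      then have "0 < e / (2 * K / b)" using \<open>0 < b\<close> \<open>1 \<le> K\<close> by simp
      then obtain M where M: "\<And>m l. M \<le> m \<Longrightarrow> M \<le> l \<Longrightarrow> norm (u m - u l) < e / (2 * K / b)"
        using CauchyD[OF \<open>Cauchy u\<close>] by blast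
      have "norm (c m i - c l i) < e" if "M \<le> m" "M \<le> l" for m l
      proof -
        obtain n where n: "i < n" "max (N m) (N l) \<le> n"
          by (rule that[of "Suc (max i (max (N m) (N l)))"]) auto
        have "norm (c m i - c l i) \<le> 2 * K / b * norm (u m - u l)"
          using coef_le[OF n(1), of "\<lambda>i. c m i - c l i"] diff[OF n(2)] by simp
        also have "\<dots> < e" using M[OF that] \<open>0 < b\<close> \<open>1 \<le> K\<close> by (simp add: field_simps)
        finally show ?thesis .
      qed
      then show "\<exists>M. \<forall>m\<ge>M. \<forall>n\<ge>M. norm (c m i - c n i) < e" by blast
    qed
    then have "\<forall>i. \<exists>l. (\<lambda>m. c m i) \<longlonglongrightarrow> l" using Cauchy_convergent_iff convergent_def by blast
    then obtain a where a: "\<And>i. (\<lambda>m. c m i) \<longlonglongrightarrow> a i" by metis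
    have close: "norm (?P (c m) n - ?P a n) \<le> K * norm (u m - v)" for m n
    proof (rule LIMSEQ_le)
      have scl_lim: "(\<lambda>l. scl (c l i) (y i)) \<longlonglongrightarrow> scl (a i) (y i)" for i
      proof -
        have "(\<lambda>l. norm (c l i - a i) * norm (y i)) \<longlonglongrightarrow> 0"
          using a[of i] by (intro tendsto_mult_left_zero tendsto_norm_zero LIM_zero)
        then have "(\<lambda>l. norm (scl (c l i) (y i) - scl (a i) (y i))) \<longlonglongrightarrow> 0"
          by (simp only: scale_left_diff_distrib[symmetric] norm_scale)
        from LIM_zero_cancel[OF tendsto_norm_zero_cancel[OF this]] show ?thesis .
      qed
      show "(\<lambda>l. norm (?P (c m) n - ?P (c l) n)) \<longlonglongrightarrow> norm (?P (c m) n - ?P a n)"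
        by (intro tendsto_norm tendsto_diff tendsto_const tendsto_sum scl_lim)
      show "(\<lambda>l. K * norm (u m - u l)) \<longlonglongrightarrow> K * norm (u m - v)"
        by (intro tendsto_mult_left tendsto_norm tendsto_diff tendsto_const u)
      have "norm (?P (c m) n - ?P (c l) n) \<le> K * norm (u m - u l)" for l
        using P_le[of n "max n (max (N m) (N l))" "\<lambda>i. c m i - c l i"] by (simp add: diff P_diff[of _ _ n])
      then show "\<exists>L. \<forall>l\<ge>L. norm (?P (c m) n - ?P (c l) n) \<le> K * norm (u m - u l)" by blast
    qed
    have "?P a \<longlonglongrightarrow> v"
    proof (rule LIMSEQ_I)
      fix e :: real assume "0 < e"
      then have "0 < e / (K + 1)" using \<open>1 \<le> K\<close> by simp
      then obtain m where m: "norm (u m - v) < e / (K + 1)"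
        using LIMSEQ_D[OF u(2)] by blast
      have "norm (?P a n - v) < e" if "N m \<le> n" for n
      proof -
        have "norm (?P a n - v) \<le> norm (?P a n - u m) + norm (u m - v)"
          using norm_triangle_ineq[of "?P a n - u m" "u m - v"] by simp
        also have "norm (?P a n - u m) \<le> K * norm (u m - v)"
          using close[of m n] N[OF that] by (simp add: norm_minus_commute)
        finally have "norm (?P a n - v) \<le> (K + 1) * norm (u m - v)" by (simp add: algebra_simps)
        also have "\<dots> < e" using m \<open>1 \<le> K\<close> by (simp add: field_simps)
        finally show ?thesis .
      qed
      then show "\<exists>M. \<forall>n\<ge>M. norm (?P a n - v) < e" by blast
    qed
    then show ?thesis by (auto simp: sums_def)
  qed
  have "range y \<subseteq> closed_linear_span scl (range y)"
    unfolding closed_linear_span_def by (rule order_trans[OF span_superset closure_subset])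
  then show ?thesis
    unfolding schauder_basis_def
    by (intro conjI ballI ex_ex1I) (auto intro: expansion unique)
qed

section \<open>Quasi-greedy subsequences\<close>
text \<open>
  If the full vector has norm \<open>1\<close>, let \<open>\<delta>\<close> be the smallest modulus of a coefficient in the greedy set
  \<open>A\<close>, and let \<open>j\<close> be least with \<open>e / (j + 1) \<le> \<delta>\<close>. Far out sums of \<open>k j\<close> such coefficients have norm at
  least \<open>5\<close>, whereas suppression allows at most \<open>4\<close>; so \<open>A\<close> has fewer than \<open>k j\<close> elements beyond \<open>j\<close>.
  Thus suppression applies to \<open>[0, j) \<union> A\<close> with constant \<open>1 + e\<close>. The indices of \<open>[0, j)\<close> outside \<open>A\<close>
  carry at most \<open>j\<close> coefficients of modulus at most \<open>\<delta>\<close>, and by the choice of \<open>j\<close> their total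
  contribution is at most \<open>j * \<delta> * B \<le> e * B\<close>.
\<close>
theorem greedy_bound_finite:
  fixes y :: "nat \<Rightarrow> 'a" and k :: "nat \<Rightarrow> nat"
  assumes "0 < e" "e \<le> 1"
    and supp: "\<And>G F j a. \<lbrakk>finite G; F \<subseteq> G \<inter> {j..}; card F \<le> k j\<rbrakk> \<Longrightarrow>
      norm (\<Sum>i\<in>(G \<inter> {..<j}) \<union> F. scl (a i) (y i)) \<le> (1 + e) * norm (\<Sum>i\<in>G. scl (a i) (y i))"
    and large: "\<And>F j a. \<lbrakk>finite F; F \<subseteq> {j..}; card F = k j; \<forall>i\<in>F. e / real (Suc j) \<le> norm (a i)\<rbrakk> \<Longrightarrow>
      5 \<le> norm (\<Sum>i\<in>F. scl (a i) (y i))"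
    and "0 < b" and b: "\<And>n. b \<le> norm (y n)" and B: "\<And>n. norm (y n) \<le> B"
    and G: "finite G" and AG: "A \<subseteq> G" and greedy: "\<And>i j. i \<in> A \<Longrightarrow> j \<in> G - A \<Longrightarrow> norm (a j) \<le> norm (a i)"
  shows "norm (\<Sum>i\<in>A. scl (a i) (y i)) \<le> (1 + e * (1 + B)) * norm (\<Sum>i\<in>G. scl (a i) (y i))"
proof -
  let ?S = "\<lambda>A. \<Sum>i\<in>A. scl (a i) (y i)"
  define N where "N = norm (?S G)"
  have "0 \<le> N" by (simp add: N_def)
  have "0 < B" using \<open>0 < b\<close> b[of 0] B[of 0] by linarith
  have proj: "norm (\<Sum>i\<in>G \<inter> {..<j}. scl (a i) (y i)) \<le> (1 + e) * norm (\<Sum>i\<in>G. scl (a i) (y i))"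
    if "finite G" for G j a
    using supp[of G "{}" j a] that by simp
  have finA: "finite A" using AG G finite_subset by blast
  have trivial: "?thesis" if "?S A = 0 \<or> ?S A = ?S G"
    using that \<open>0 < e\<close> \<open>0 < B\<close> by (auto intro!: mult_nonneg_nonneg simp: algebra_simps)
  show ?thesis
  proof (cases "A = {} \<or> N = 0 \<or> (\<exists>i\<in>A. a i = 0)")
    case True
    have "?S A = 0" if "N = 0"
    proof (rule sum.neutral, rule)
      fix i assume "i \<in> A"
      then have "norm (a i) * b \<le> 0"
        using coefficient_bound[where K = "1 + e" and y = y, OF proj b G, of i a] AG that
        by (auto simp: N_def)
      then show "scl (a i) (y i) = 0" using \<open>0 < b\<close> by (simp add: mult_le_0_iff)
    qed
    moreover have "?S A = ?S G" if "i \<in> A" "a i = 0" for i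
      using greedy[OF that(1)] that(2) AG G by (intro sum.mono_neutral_left) auto
    ultimately show ?thesis using True by (intro trivial) auto
  next
    case False
    then have "0 < N" using \<open>0 \<le> N\<close> by simp
    define \<delta> where "\<delta> = Min ((\<lambda>i. norm (a i)) ` A)"
    have "\<delta> \<in> (\<lambda>i. norm (a i)) ` A" unfolding \<delta>_def using finA False by (intro Min_in) auto
    then obtain i0 where i0: "i0 \<in> A" "norm (a i0) = \<delta>" by auto
    have "0 < \<delta>" using i0 False by auto
    have \<delta>: "\<delta> \<le> norm (a i)" if "i \<in> A" for i unfolding \<delta>_def using finA that by (intro Min_le) auto
    define j where "j = (LEAST j. e * N \<le> \<delta> * real (Suc j))"
    obtain n where "e * N / \<delta> < real n" using reals_Archimedean2 by blast
    then have "e * N \<le> \<delta> * real (Suc n)" using \<open>0 < \<delta>\<close> by (simp add: field_simps)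
    then have j: "e * N \<le> \<delta> * real (Suc j)" unfolding j_def by (rule LeastI)
    have j_small: "\<delta> * real j \<le> e * N"
    proof (cases j)
      case (Suc j')
      then have "\<not> e * N \<le> \<delta> * real (Suc j')" using not_less_Least[of j' "\<lambda>j. e * N \<le> \<delta> * real (Suc j)"] unfolding j_def[symmetric] by simp
      with Suc show ?thesis by simp
    qed (use \<open>0 < e\<close> \<open>0 < N\<close> in simp)
    define F where "F = A \<inter> {j..}"
    have FG: "F \<subseteq> G \<inter> {j..}" and finF: "finite F" using AG finA by (auto simp: F_def)
    have "card F < k j"
    proof (rule ccontr)
      assume "\<not> ?thesis"
      then have "k j \<le> card F" by simp
      then obtain F' where F': "F' \<subseteq> F" "card F' = k j" and finF': "finite F'"
        by (rule obtain_subset_with_card_n)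
      have "norm (?S ((G \<inter> {..<j}) \<union> F')) \<le> (1 + e) * N"
        unfolding N_def using F' FG G by (intro supp) auto
      moreover have "norm (?S (G \<inter> {..<j})) \<le> (1 + e) * N" unfolding N_def by (rule proj[OF G])
      moreover have "?S ((G \<inter> {..<j}) \<union> F') = ?S (G \<inter> {..<j}) + ?S F'"
        using G finF' F'(1) by (intro sum.union_disjoint) (auto simp: F_def)
      moreover have "(1 + e) * N \<le> 2 * N" using \<open>e \<le> 1\<close> \<open>0 < N\<close> by (intro mult_right_mono) auto
      ultimately have le4: "norm (?S F') \<le> 4 * N"
        using norm_triangle_ineq4[of "?S (G \<inter> {..<j}) + ?S F'" "?S (G \<inter> {..<j})"] by simp
      have "5 \<le> norm (\<Sum>i\<in>F'. scl (a i / of_real N) (y i))"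
      proof (rule large[OF finF' _ F'(2)])
        show "F' \<subseteq> {j..}" using F'(1) by (auto simp: F_def)
        show "\<forall>i\<in>F'. e / real (Suc j) \<le> norm (a i / of_real N)"
        proof
          fix i assume "i \<in> F'"
          then have "\<delta> \<le> norm (a i)" using F'(1) by (intro \<delta>) (auto simp: F_def)
          then have "\<delta> * real (Suc j) \<le> norm (a i) * real (Suc j)" by (intro mult_right_mono) auto
          with j have "e * N \<le> norm (a i) * real (Suc j)" by linarith
          then show "e / real (Suc j) \<le> norm (a i / of_real N)"
            using \<open>0 < N\<close> by (simp add: norm_divide divide_simps mult.commute)
        qed
      qed
      also have "(\<Sum>i\<in>F'. scl (a i / of_real N) (y i)) = scl (1 / of_real N) (?S F')"
        by (simp add: scale_sum_right)
      also have "norm \<dots> = norm (?S F') / N" using \<open>0 < N\<close> by (simp add: norm_scale norm_divide)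
      finally show False using le4 \<open>0 < N\<close> by (simp add: field_simps)
    qed
    let ?E = "(G \<inter> {..<j}) \<union> F" and ?R = "(G \<inter> {..<j}) - A"
    have E: "norm (?S ?E) \<le> (1 + e) * N"
      unfolding N_def using FG G \<open>card F < k j\<close> by (intro supp) auto
    have "A \<union> ?R = ?E" "A \<inter> ?R = {}" using AG by (auto simp: F_def)
    then have "?S ?E = ?S A + ?S ?R"
      using sum.union_disjoint[of A ?R "\<lambda>i. scl (a i) (y i)"] finA G by simp
    then have "norm (?S A) \<le> norm (?S ?E) + norm (?S ?R)"
      using norm_triangle_ineq4[of "?S ?E" "?S ?R"] by simp
    also have "norm (?S ?R) \<le> real (card ?R) * (\<delta> * B)"
    proof (rule sum_norm_bound)
      fix i assume "i \<in> ?R"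
      then have "norm (a i) \<le> \<delta>" using greedy[OF i0(1), of i] i0(2) by simp
      then show "norm (scl (a i) (y i)) \<le> \<delta> * B"
        using B[of i] \<open>0 < \<delta>\<close> by (simp add: norm_scale mult_mono)
    qed
    also have "\<dots> \<le> real j * (\<delta> * B)"
    proof -
      have "card ?R \<le> card {..<j}" by (intro card_mono) auto
      then show ?thesis using \<open>0 < \<delta>\<close> \<open>0 < B\<close> by (intro mult_right_mono) auto
    qed
    also have "\<dots> \<le> e * N * B"
      using mult_right_mono[OF j_small, of B] \<open>0 < B\<close> by (simp add: mult_ac)
    finally have "norm (?S A) \<le> (1 + e) * N + e * N * B" using E by linarith
    then show ?thesis unfolding N_def[symmetric] by (simp add: algebra_simps)
  qed
qed

lemma seminormalized_comp:
  assumes "seminormalized (x :: nat \<Rightarrow> 'a)"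
  shows "seminormalized (x \<circ> r)"
proof -
  obtain b B where "0 < b" and b: "\<And>n. b \<le> norm (x n)" and B: "\<And>n. norm (x n) \<le> B"
    using seminormalizedE[OF assms] by metis
  have "b \<le> (INF n. norm ((x \<circ> r) n))" using b by (intro cINF_greatest) auto
  with \<open>0 < b\<close> B show ?thesis
    unfolding seminormalized_def by (auto intro!: bdd_aboveI2[of _ _ B])
qed

lemma weakly_null_comp:
  assumes "weakly_null scl x" "strict_mono r"
  shows "weakly_null scl (x \<circ> r)"
  unfolding weakly_null_def
proof (intro allI impI)
  fix f assume "Vector_Spaces.linear scl (*) f \<and> continuous_on UNIV f"
  then have "(\<lambda>n. f (x n)) \<longlonglongrightarrow> 0" using assms(1) unfolding weakly_null_def by blast
  from LIMSEQ_subseq_LIMSEQ[OF this assms(2)] show "(\<lambda>n. f ((x \<circ> r) n)) \<longlonglongrightarrow> 0"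
    by (simp add: o_def)
qed

text \<open>
  The thresholds \<open>k j\<close> at which far out sums of coefficients \<open>e / (j + 1)\<close> become large do not change
  when passing to a subsequence. This makes it possible to fix them first and then
  choose a subsequence on which sets of size \<open>k j\<close> beyond \<open>j\<close> can be suppressed.
\<close>
theorem quasi_greedy_subsequence:
  assumes sn: "seminormalized x" and wn: "weakly_null scl x"
    and no_c0: "\<forall>r :: nat \<Rightarrow> nat. strict_mono r \<longrightarrow> \<not> has_c0_spreading_model scl (x \<circ> r)"
    and "0 < \<epsilon>"
  shows "\<exists>r :: nat \<Rightarrow> nat. strict_mono r \<and>
    quasi_greedy_basis scl (x \<circ> r) (closed_linear_span scl (range (x \<circ> r))) (1 + \<epsilon>)"
proof -
  obtain b B where "0 < b" "0 < B" and b: "\<And>n. b \<le> norm (x n)" and B: "\<And>n. norm (x n) \<le> B"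
    using seminormalizedE[OF sn] by metis
  define e where "e = min 1 (\<epsilon> / (1 + B))"
  have "0 < e" "e \<le> 1" using \<open>0 < \<epsilon>\<close> \<open>0 < B\<close> by (auto simp: e_def)
  have "e \<le> \<epsilon> / (1 + B)" by (simp add: e_def)
  then have e_B: "e * (1 + B) \<le> \<epsilon>" using \<open>0 < B\<close> by (simp add: pos_le_divide_eq)
  obtain r1 :: "nat \<Rightarrow> nat" where r1: "strict_mono r1"
    and far: "\<forall>\<delta>>0. \<forall>H. \<exists>k m. \<forall>F a.
      finite F \<and> F \<subseteq> {m..} \<and> card F = k \<and> (\<forall>i\<in>F. \<delta> \<le> norm (a i)) \<longrightarrow>
      H \<le> norm (\<Sum>i\<in>F. scl (a i) (x (r1 i)))"
    using far_sums_large[OF wn sn no_c0] by (elim exE conjE) (erule (1) that)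
  define good where "good j k m \<longleftrightarrow> (\<forall>F a.
      finite F \<and> F \<subseteq> {m..} \<and> card F = k \<and> (\<forall>i\<in>F. e / real (Suc j) \<le> norm (a i)) \<longrightarrow>
      5 \<le> norm (\<Sum>i\<in>F. scl (a i) (x (r1 i))))" for j k and m :: nat
  have "\<forall>j. \<exists>k m. good j k m"
    unfolding good_def using far \<open>0 < e\<close> by simp
  then obtain k m where "\<And>j. good j (k j) (m j)" by metis
  then have km: "5 \<le> norm (\<Sum>i\<in>F. scl (a i) (x (r1 i)))"
    if "finite F" "F \<subseteq> {m j..}" "card F = k j" "\<forall>i\<in>F. e / real (Suc j) \<le> norm (a i)" for j F a
    using that unfolding good_def by blast
  \<comment> \<open>Along \<open>g\<close>, and along every subsequence of it, the indices from \<open>j\<close> onwards are far out for \<open>j\<close>.\<close>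
  define g where "g j = j + (\<Sum>i\<le>j. m i)" for j :: nat
  have g: "strict_mono g"
    unfolding g_def by (rule strict_monoI_Suc) simp
  have m_le: "m j \<le> g i" if "j \<le> i" for i j
    using member_le_sum[of j "{..i}" m] that by (simp add: g_def)
  have "strict_mono (r1 \<circ> g)" using r1 g by (rule strict_mono_o)
  then obtain r2 where r2: "strict_mono r2"
    and supp: "\<forall>G F j a. finite G \<longrightarrow> F \<subseteq> G \<inter> {j..} \<longrightarrow> card F \<le> k j \<longrightarrow>
      norm (\<Sum>i\<in>(G \<inter> {..<j}) \<union> F. scl (a i) ((x \<circ> (r1 \<circ> g)) (r2 i)))
        \<le> (1 + e) * norm (\<Sum>i\<in>G. scl (a i) ((x \<circ> (r1 \<circ> g)) (r2 i)))"
    using schreier_suppression[where M = k, OF weakly_null_comp[OF wn] seminormalized_comp[OF sn] \<open>0 < e\<close>]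
    by blast
  define y where "y = x \<circ> (r1 \<circ> g \<circ> r2)"
  have y_supp: "norm (\<Sum>i\<in>(G \<inter> {..<j}) \<union> F. scl (a i) (y i)) \<le> (1 + e) * norm (\<Sum>i\<in>G. scl (a i) (y i))"
    if "finite G" "F \<subseteq> G \<inter> {j..}" "card F \<le> k j" for G F j a
    using supp[rule_format, OF that, of a] by (simp add: y_def)
  have y_large: "5 \<le> norm (\<Sum>i\<in>F. scl (a i) (y i))"
    if F: "finite F" "F \<subseteq> {j..}" "card F = k j" and a: "\<forall>i\<in>F. e / real (Suc j) \<le> norm (a i)" for F j a
  proof -
    define h where "h = g \<circ> r2"
    have "strict_mono h" unfolding h_def using g r2 by (rule strict_mono_o)
    then have inj: "inj h" by (rule strict_mono_imp_inj_on)
    then have inj': "inj_on h F" by (rule inj_on_subset) simp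
    have "m j \<le> h i" if "i \<in> F" for i
    proof -
      have "j \<le> i" using that F(2) by auto
      then have "j \<le> r2 i" using seq_suble[OF r2, of i] by linarith
      then show ?thesis using m_le by (simp add: h_def)
    qed
    then have "h ` F \<subseteq> {m j..}" by auto
    moreover have "card (h ` F) = k j" using F(3) by (simp only: card_image[OF inj'])
    moreover have "\<forall>i\<in>h ` F. e / real (Suc j) \<le> norm (a (inv h i))"
      using a by (auto simp: inv_f_f[OF inj])
    ultimately have "5 \<le> norm (\<Sum>i\<in>h ` F. scl (a (inv h i)) (x (r1 i)))"
      using F(1) by (intro km) auto
    also have "(\<Sum>i\<in>h ` F. scl (a (inv h i)) (x (r1 i))) = (\<Sum>i\<in>F. scl (a i) (y i))"
      unfolding sum.reindex[OF inj'] by (intro sum.cong) (simp_all add: inv_f_f[OF inj], simp add: y_def h_def)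
    finally show ?thesis .
  qed
  have y_b: "b \<le> norm (y n)" and y_B: "norm (y n) \<le> B" for n using b B by (simp_all add: y_def)
  have basis: "schauder_basis scl y (closed_linear_span scl (range y))"
  proof (rule schauder_basis_if_bounded_projections[where K = "1 + e", OF _ \<open>0 < b\<close> y_b])
    show "norm (\<Sum>i\<in>G \<inter> {..<j}. scl (a i) (y i)) \<le> (1 + e) * norm (\<Sum>i\<in>G. scl (a i) (y i))"
      if "finite G" for G j a using y_supp[of G "{}" j a] that by simp
  qed
  have greedy: "norm (\<Sum>i\<in>A. scl (a i) (y i)) \<le> (1 + \<epsilon>) * norm v"
    if sums: "(\<lambda>i. scl (a i) (y i)) sums v" and A: "greedy_set a n A" for a v n A
  proof -
    have "finite A" using A by (simp add: greedy_set_def)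
    then obtain N where N: "A \<subseteq> {..<N}" by (auto simp: finite_nat_iff_bounded)
    have "norm (\<Sum>i\<in>A. scl (a i) (y i)) \<le> (1 + e * (1 + B)) * norm v"
    proof (rule LIMSEQ_le_const)
      show "(\<lambda>n. (1 + e * (1 + B)) * norm (\<Sum>i<n. scl (a i) (y i))) \<longlonglongrightarrow> (1 + e * (1 + B)) * norm v"
        using sums unfolding sums_def by (intro tendsto_intros)
      have "norm (\<Sum>i\<in>A. scl (a i) (y i)) \<le> (1 + e * (1 + B)) * norm (\<Sum>i<n. scl (a i) (y i))"
        if "N \<le> n" for n
      proof (rule greedy_bound_finite[OF \<open>0 < e\<close> \<open>e \<le> 1\<close> y_supp y_large \<open>0 < b\<close> y_b y_B])
        show "A \<subseteq> {..<n}" using N that by auto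
        show "norm (a j) \<le> norm (a i)" if "i \<in> A" "j \<in> {..<n} - A" for i j
          using A that unfolding greedy_set_def by blast
      qed auto
      then show "\<exists>N. \<forall>n\<ge>N. norm (\<Sum>i\<in>A. scl (a i) (y i))
          \<le> (1 + e * (1 + B)) * norm (\<Sum>i<n. scl (a i) (y i))" by blast
    qed
    also have "\<dots> \<le> (1 + \<epsilon>) * norm v" using e_B by (intro mult_right_mono) auto
    finally show ?thesis .
  qed
  have "seminormalized y" unfolding y_def by (rule seminormalized_comp[OF sn])
  with basis greedy have "quasi_greedy_basis scl y (closed_linear_span scl (range y)) (1 + \<epsilon>)"
    unfolding quasi_greedy_basis_def by blast
  moreover have "strict_mono (r1 \<circ> g \<circ> r2)" using r1 g r2 by (intro strict_mono_o)
  ultimately show ?thesis unfolding y_def by blast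
qed

end

theorem theorem5:
  fixes scl :: "'k::{real_normed_field, euclidean_space} \<Rightarrow> 'a::banach \<Rightarrow> 'a"
    and x :: "nat \<Rightarrow> 'a" and \<epsilon> :: real
  assumes "banach_space_over scl"
    and "seminormalized x"
    and "weakly_null scl x"
    and "\<And>r :: nat \<Rightarrow> nat. strict_mono r \<Longrightarrow> \<not> has_c0_spreading_model scl (x \<circ> r)"
    and "\<epsilon> > 0"
  shows "\<exists>r :: nat \<Rightarrow> nat. strict_mono r \<and>
    quasi_greedy_basis scl (x \<circ> r) (closed_linear_span scl (range (x \<circ> r))) (1 + \<epsilon>)"
  using banach_space_over.quasi_greedy_subsequence[OF assms(1-3) _ assms(5)] assms(4) by blast

end
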